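(* There is a polynomial $p$ such that for any two shape expression schemas $H$ and $K$ with $L(H)\not\subseteq L(K)$, there exists a compressed graph $\mathcal F$ that satisfies $H$, does not satisfy $K$, and whose size (with cardinalities written in binary) is at most $2^{2^{p(|H|+|K|)}}$.
   Context: Fix a finite set $\Sigma$ of edge labels. An interval $[n;m]$ with $n\in\mathbb N$, $m\in\mathbb N\cup\{\infty\}$, $n\le m$, denotes $\{i\in\mathbb N: n\le i\le m\}$, bounds stored in binary. Regular bag expressions (RBE) over a finite alphabet $\Delta$: $E::=\epsilon\mid a\mid (E\mid E)\mid (E\,\|\,E)\mid E^I$ with $a\in\Delta$ and $I$ an arbitrary interval; semantics (sets of bags): $L(\epsilon)=\{\text{empty bag}\}$, $L(a)=\{\{\!|a|\!\}\}$, $L(E_1\mid E_2)=L(E_1)\cup L(E_2)$, $L(E_1\|E_2)=\{w_1\uplus w_2: w_i\in L(E_i)\}$ ($\uplus$ is bag union), $L(E^I)=\bigcup_{i\in I}L(E)^i$ with $L^0=\{\text{empty bag}\}$, $L^i=L\uplus L^{i-1}$. A shape expression schema is $S=(\Gamma_S,\delta_S)$ with $\Gamma_S$ a finite set of types and $\delta_S$ mapping each type to an RBE over $\Sigma\times\Gamma_S$ (elements written $a::t$); its size $|S|$ is the length of its description. A simple graph is $G=(N,E,\mathsf{source},\mathsf{target},\mathsf{lab})$ with finite node and edge sets, $\mathsf{source},\mathsf{target}:E\to N$, $\mathsf{lab}:E\to\Sigma$, no two distinct edges having the same source, target and label; each edge is regarded as carrying interval $[1;1]$. A compressed graph is the same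 except each edge $e$ carries a singleton interval $\mathsf{occur}(e)=[k;k]$ ($k\in\mathbb N$ in binary). For either kind of graph, a typing is $T\subseteq N\times\Gamma_S$; the signature of $n$ w.r.t. $T$ is the RBE $\|_{e\in\mathsf{out}(n)}\big(|_{t\in T(\mathsf{target}(e))}\mathsf{lab}(e)::t\big)^{\mathsf{occur}(e)}$, where $\mathsf{out}(n)$ is the set of edges with source $n$. $T$ is valid if $L(\mathrm{sign}^T(n))\cap L(\delta_S(t))\neq\emptyset$ for every $(n,t)\in T$. There is a unique maximal valid typing, and the graph satisfies $S$ if every node is assigned at least one type by it. $L(S)$ is the set of simple graphs satisfying $S$. *)

theory Defs
  imports
    "HOL-Library.Multiset"
    "HOL-Library.Extended_Nat"
    "HOL-Library.Log_Nat"
    "HOL-Computational_Algebra.Polynomial"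
begin

section \<open>Intervals\<close>

datatype interval = Interval (lo: nat) (hi: enat)

definition interval_set :: "interval \<Rightarrow> nat set" where
  "interval_set I = {i. lo I \<le> i \<and> enat i \<le> hi I}"

definition wf_interval :: "interval \<Rightarrow> bool" where
  "wf_interval I \<longleftrightarrow> enat (lo I) \<le> hi I"

definition singleton_interval :: "nat \<Rightarrow> interval" where
  "singleton_interval k = Interval k (enat k)"

section \<open>Regular bag expressions\<close>

text \<open>
  \<open>Empty\<close> is the disjunction over the empty index set. It is needed for signatures
  (a target node may have no type) but is not part of the grammar used in schemas:
  \<open>rbe_over\<close> rejects it.
\<close>

datatype 'a rbe =
    Empty
  | Eps
  | Atom 'a
  | Alt "'a rbe" "'a rbe"
  | Conc "'a rbe" "'a rbe"
  | Rep "'a rbe" interval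

primrec rbe_over :: "'a set \<Rightarrow> 'a rbe \<Rightarrow> bool" where
  "rbe_over \<Delta> Empty \<longleftrightarrow> False"
| "rbe_over \<Delta> Eps \<longleftrightarrow> True"
| "rbe_over \<Delta> (Atom a) \<longleftrightarrow> a \<in> \<Delta>"
| "rbe_over \<Delta> (Alt E F) \<longleftrightarrow> rbe_over \<Delta> E \<and> rbe_over \<Delta> F"
| "rbe_over \<Delta> (Conc E F) \<longleftrightarrow> rbe_over \<Delta> E \<and> rbe_over \<Delta> F"
| "rbe_over \<Delta> (Rep E I) \<longleftrightarrow> rbe_over \<Delta> E \<and> wf_interval I"

definition bag_conc :: "'a multiset set \<Rightarrow> 'a multiset set \<Rightarrow> 'a multiset set" where
  "bag_conc A B = {v + w | v w. v \<in> A \<and> w \<in> B}"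

primrec bag_power :: "'a multiset set \<Rightarrow> nat \<Rightarrow> 'a multiset set" where
  "bag_power A 0 = {{#}}"
| "bag_power A (Suc i) = bag_conc A (bag_power A i)"

primrec rbe_lang :: "'a rbe \<Rightarrow> 'a multiset set" where
  "rbe_lang Empty = {}"
| "rbe_lang Eps = {{#}}"
| "rbe_lang (Atom a) = {{#a#}}"
| "rbe_lang (Alt E F) = rbe_lang E \<union> rbe_lang F"
| "rbe_lang (Conc E F) = bag_conc (rbe_lang E) (rbe_lang F)"
| "rbe_lang (Rep E I) = (\<Union>i\<in>interval_set I. bag_power (rbe_lang E) i)"

definition big_alt :: "'a rbe list \<Rightarrow> 'a rbe" where
  "big_alt Es = foldr Alt Es Empty"

definition big_conc :: "'a rbe list \<Rightarrow> 'a rbe" where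
  "big_conc Es = foldr Conc Es Eps"

section \<open>Schemas and graphs\<close>

text \<open>
  Type names, nodes and edges are natural numbers. All these sets are finite, so this only
  fixes a representative up to renaming.
\<close>

record 'l schema =
  types :: "nat set"
  delta :: "nat \<Rightarrow> ('l \<times> nat) rbe"

definition wf_schema :: "'l set \<Rightarrow> 'l schema \<Rightarrow> bool" where
  "wf_schema \<Sigma> S \<longleftrightarrow>
     finite (types S) \<and> (\<forall>t\<in>types S. rbe_over (\<Sigma> \<times> types S) (delta S t))"

record 'l graph =
  nodes :: "nat set"
  edges :: "nat set"
  source :: "nat \<Rightarrow> nat"
  target :: "nat \<Rightarrow> nat"
  lab :: "nat \<Rightarrow> 'l"
  occur :: "nat \<Rightarrow> interval"

definition wf_graph :: "'l set \<Rightarrow> 'l graph \<Rightarrow> bool" where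
  "wf_graph \<Sigma> G \<longleftrightarrow>
     finite (nodes G) \<and> finite (edges G) \<and>
     (\<forall>e\<in>edges G. source G e \<in> nodes G \<and> target G e \<in> nodes G \<and> lab G e \<in> \<Sigma>) \<and>
     inj_on (\<lambda>e. (source G e, target G e, lab G e)) (edges G)"

definition simple_graph :: "'l set \<Rightarrow> 'l graph \<Rightarrow> bool" where
  "simple_graph \<Sigma> G \<longleftrightarrow>
     wf_graph \<Sigma> G \<and> (\<forall>e\<in>edges G. occur G e = singleton_interval 1)"

definition compressed_graph :: "'l set \<Rightarrow> 'l graph \<Rightarrow> bool" where
  "compressed_graph \<Sigma> G \<longleftrightarrow>
     wf_graph \<Sigma> G \<and> (\<forall>e\<in>edges G. \<exists>k. occur G e = singleton_interval k)"

section \<open>Typings and satisfaction\<close>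

definition out_edges :: "'l graph \<Rightarrow> nat \<Rightarrow> nat set" where
  "out_edges G n = {e \<in> edges G. source G e = n}"

text \<open>
  The signature is an expression, so its index sets have to be listed in some order; the
  increasing one is used. The language does not depend on it, see \<open>signature_lang\<close> below.
\<close>

definition signature :: "'l graph \<Rightarrow> (nat \<times> nat) set \<Rightarrow> nat \<Rightarrow> ('l \<times> nat) rbe" where
  "signature G T n =
     big_conc (map (\<lambda>e.
         Rep (big_alt (map (\<lambda>t. Atom (lab G e, t)) (sorted_list_of_set (T `` {target G e}))))
             (occur G e))
       (sorted_list_of_set (out_edges G n)))"

definition valid_typing :: "'l graph \<Rightarrow> 'l schema \<Rightarrow> (nat \<times> nat) set \<Rightarrow> bool" where
  "valid_typing G S T \<longleftrightarrow>
     T \<subseteq> nodes G \<times> types S \<and>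
     (\<forall>(n, t)\<in>T. rbe_lang (signature G T n) \<inter> rbe_lang (delta S t) \<noteq> {})"

definition max_typing :: "'l graph \<Rightarrow> 'l schema \<Rightarrow> (nat \<times> nat) set" where
  "max_typing G S = (GREATEST T. valid_typing G S T)"

definition satisfies :: "'l graph \<Rightarrow> 'l schema \<Rightarrow> bool" where
  "satisfies G S \<longleftrightarrow> (\<forall>n\<in>nodes G. \<exists>t. (n, t) \<in> max_typing G S)"

definition schema_lang :: "'l set \<Rightarrow> 'l schema \<Rightarrow> 'l graph set" where
  "schema_lang \<Sigma> S = {G. simple_graph \<Sigma> G \<and> satisfies G S}"

section \<open>Sizes\<close>

text \<open>
  Sizes are lengths of descriptions: numbers are written in binary, an element of a finite
  set \<open>A\<close> of names is written with \<open>nbits (card A)\<close> bits, and every other symbol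
  (operators, \<open>\<epsilon>\<close>, \<open>\<infinity>\<close>) counts 1.
\<close>

definition nbits :: "nat \<Rightarrow> nat" where
  "nbits k = max 1 (floorlog 2 k)"

definition interval_size :: "interval \<Rightarrow> nat" where
  "interval_size I = nbits (lo I) + (case hi I of enat m \<Rightarrow> nbits m | \<infinity> \<Rightarrow> 1)"

text \<open>The parameter \<open>c\<close> is the length of one alphabet symbol.\<close>

primrec rbe_size :: "nat \<Rightarrow> 'a rbe \<Rightarrow> nat" where
  "rbe_size c Empty = 1"
| "rbe_size c Eps = 1"
| "rbe_size c (Atom a) = c"
| "rbe_size c (Alt E F) = 1 + rbe_size c E + rbe_size c F"
| "rbe_size c (Conc E F) = 1 + rbe_size c E + rbe_size c F"
| "rbe_size c (Rep E I) = 1 + rbe_size c E + interval_size I"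

definition schema_size :: "'l set \<Rightarrow> 'l schema \<Rightarrow> nat" where
  "schema_size \<Sigma> S =
     (\<Sum>t\<in>types S. nbits (card (types S)) +
        rbe_size (nbits (card \<Sigma>) + nbits (card (types S))) (delta S t))"

text \<open>
  A graph is described by its nodes and, for every edge, its source, target, label and
  interval; edges need no names since these data determine them.
\<close>

definition graph_size :: "'l set \<Rightarrow> 'l graph \<Rightarrow> nat" where
  "graph_size \<Sigma> G =
     (\<Sum>n\<in>nodes G. nbits (card (nodes G))) +
     (\<Sum>e\<in>edges G. 2 * nbits (card (nodes G)) + nbits (card \<Sigma>) + interval_size (occur G e))"

section \<open>Well-definedness\<close>

lemma bag_conc_mono: "A \<subseteq> A' \<Longrightarrow> B \<subseteq> B' \<Longrightarrow> bag_conc A B \<subseteq> bag_conc A' B'"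
  unfolding bag_conc_def by blast

lemma bag_power_mono: "A \<subseteq> A' \<Longrightarrow> bag_power A i \<subseteq> bag_power A' i"
  by (induction i) (simp_all add: bag_conc_mono)

lemma rbe_lang_big_alt: "rbe_lang (big_alt Es) = (\<Union>E\<in>set Es. rbe_lang E)"
  by (induction Es) (auto simp: big_alt_def)

lemma rbe_lang_big_conc:
  "rbe_lang (big_conc (map f xs)) =
     {(\<Sum>x\<leftarrow>xs. w x) | w. \<forall>x\<in>set xs. w x \<in> rbe_lang (f x)}"
  if "distinct xs"
  using that
proof (induction xs)
  case Nil
  then show ?case by (simp add: big_conc_def)
next
  case (Cons a xs)
  have IH: "rbe_lang (big_conc (map f xs)) =
     {(\<Sum>x\<leftarrow>xs. w x) | w. \<forall>x\<in>set xs. w x \<in> rbe_lang (f x)}"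
    using Cons by simp
  have eq: "rbe_lang (big_conc (map f (a # xs))) =
      bag_conc (rbe_lang (f a)) (rbe_lang (big_conc (map f xs)))"
    by (simp add: big_conc_def)
  show ?case
  proof (intro equalityI subsetI)
    fix u assume "u \<in> rbe_lang (big_conc (map f (a # xs)))"
    then obtain v w where v: "v \<in> rbe_lang (f a)"
      and w: "\<forall>x\<in>set xs. w x \<in> rbe_lang (f x)" and u: "u = v + (\<Sum>x\<leftarrow>xs. w x)"
      unfolding eq IH bag_conc_def by blast
    have "(\<Sum>x\<leftarrow>xs. (w(a := v)) x) = (\<Sum>x\<leftarrow>xs. w x)"
      using Cons.prems by (intro arg_cong[where f = sum_list] map_cong) auto
    then have "u = (\<Sum>x\<leftarrow>a # xs. (w(a := v)) x)" using u by simp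
    moreover have "\<forall>x\<in>set (a # xs). (w(a := v)) x \<in> rbe_lang (f x)" using v w by simp
    ultimately show "u \<in> {(\<Sum>x\<leftarrow>a # xs. w x) | w. \<forall>x\<in>set (a # xs). w x \<in> rbe_lang (f x)}"
      by blast
  next
    fix u assume "u \<in> {(\<Sum>x\<leftarrow>a # xs. w x) | w. \<forall>x\<in>set (a # xs). w x \<in> rbe_lang (f x)}"
    then show "u \<in> rbe_lang (big_conc (map f (a # xs)))"
      unfolding eq IH bag_conc_def by auto
  qed
qed

lemma signature_lang:
  assumes "finite (edges G)" "finite T"
  shows "rbe_lang (signature G T n) =
    {(\<Sum>e\<in>out_edges G n. w e) | w. \<forall>e\<in>out_edges G n.
       w e \<in> (\<Union>i\<in>interval_set (occur G e). bag_power {{#(lab G e, t)#} | t. (target G e, t) \<in> T} i)}"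
proof -
  let ?f = "\<lambda>e. Rep (big_alt (map (\<lambda>t. Atom (lab G e, t)) (sorted_list_of_set (T `` {target G e})))) (occur G e)"
  let ?L = "\<lambda>e. \<Union>i\<in>interval_set (occur G e).
    bag_power {{#(lab G e, t)#} | t. (target G e, t) \<in> T} i"
  let ?xs = "sorted_list_of_set (out_edges G n)"
  have set_xs: "set ?xs = out_edges G n"
    using assms(1) by (simp add: out_edges_def)
  have alt: "rbe_lang (big_alt (map (\<lambda>t. Atom (lab G e, t)) (sorted_list_of_set (T `` {target G e})))) =
      {{#(lab G e, t)#} | t. (target G e, t) \<in> T}" for e
    using finite_Image[OF assms(2), of "{target G e}"] by (auto simp: rbe_lang_big_alt)
  have f: "rbe_lang (?f e) = ?L e" for e
    by (simp only: rbe_lang.simps alt)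
  have sum: "(\<Sum>e\<leftarrow>?xs. w e) = (\<Sum>e\<in>out_edges G n. w e)" for w :: "nat \<Rightarrow> ('a \<times> nat) multiset"
    by (simp only: sum_list_distinct_conv_sum_set distinct_sorted_list_of_set set_xs)
  have "rbe_lang (signature G T n) =
      {(\<Sum>e\<leftarrow>?xs. w e) | w. \<forall>e\<in>set ?xs. w e \<in> rbe_lang (?f e)}"
    unfolding signature_def by (rule rbe_lang_big_conc) (rule distinct_sorted_list_of_set)
  then show ?thesis
    by (simp only: f sum set_xs)
qed

lemma signature_mono:
  assumes "finite (edges G)" "finite T'" "T \<subseteq> T'"
  shows "rbe_lang (signature G T n) \<subseteq> rbe_lang (signature G T' n)"
proof -
  let ?L = "\<lambda>T e. \<Union>i\<in>interval_set (occur G e).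
    bag_power {{#(lab G e, t)#} | t. (target G e, t) \<in> T} i"
  have sub: "?L T e \<subseteq> ?L T' e" for e
    using assms(3) by (intro UN_mono bag_power_mono order_refl) blast
  have "finite T" using assms finite_subset by blast
  show ?thesis
  proof
    fix u assume "u \<in> rbe_lang (signature G T n)"
    then obtain w where u: "u = (\<Sum>e\<in>out_edges G n. w e)"
      and w: "\<forall>e\<in>out_edges G n. w e \<in> ?L T e"
      unfolding signature_lang[OF assms(1) \<open>finite T\<close>] by (elim CollectE exE conjE)
    have "\<forall>e\<in>out_edges G n. w e \<in> ?L T' e"
      using w sub by (intro ballI) (rule subsetD[OF sub], rule bspec)
    with u show "u \<in> rbe_lang (signature G T' n)"
      unfolding signature_lang[OF assms(1,2)] by (intro CollectI exI conjI)
  qed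
qed

lemma max_typing_greatest:
  assumes "wf_graph \<Sigma> G" "wf_schema \<Sigma> S"
  shows "valid_typing G S (max_typing G S)"
    and "valid_typing G S T \<Longrightarrow> T \<subseteq> max_typing G S"
    and "max_typing G S = \<Union>{T. valid_typing G S T}"
proof -
  let ?U = "\<Union>{T. valid_typing G S T}"
  have fe: "finite (edges G)" using assms by (simp add: wf_graph_def)
  have sub: "?U \<subseteq> nodes G \<times> types S" by (auto simp: valid_typing_def)
  have fU: "finite ?U"
    by (rule finite_subset[OF sub]) (use assms in \<open>simp add: wf_graph_def wf_schema_def\<close>)
  have "rbe_lang (signature G ?U n) \<inter> rbe_lang (delta S t) \<noteq> {}" if nt: "(n, t) \<in> ?U" for n t
  proof -
    obtain T where T: "valid_typing G S T" "(n, t) \<in> T" using nt by blast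
    then have "rbe_lang (signature G T n) \<inter> rbe_lang (delta S t) \<noteq> {}"
      unfolding valid_typing_def by blast
    moreover have "rbe_lang (signature G T n) \<subseteq> rbe_lang (signature G ?U n)"
      using T by (intro signature_mono fe fU) blast
    ultimately show ?thesis by blast
  qed
  then have U: "valid_typing G S ?U" using sub unfolding valid_typing_def by blast
  show eq: "max_typing G S = ?U"
    unfolding max_typing_def by (rule Greatest_equality[where P = "valid_typing G S"]) (use U in auto)
  show "valid_typing G S (max_typing G S)" using U eq by simp
  show "valid_typing G S T \<Longrightarrow> T \<subseteq> max_typing G S" using eq by blast
qed

end

theory Submission
  imports Defs
begin

text \<open>
  Label every node of a simple counterexample with its \<open>H\<close>-types and, for every \<open>i\<close>, with the
  \<open>K\<close>-types that survive \<open>i\<close> rounds of the refinement computing the maximal typing. The pairs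
  that occur (kinds), at most exponentially many, become the nodes of the compressed graph. The
  outgoing edges of a kind are copied from a node that has this kind at the earliest possible
  stage \<open>i\<close>, with the targets taken at stage \<open>i - 1\<close>; induction on that stage shows that a kind gets
  no additional \<open>K\<close>-types.

  The multiplicities are then made small. By Hall's theorem a signature meets \<open>L(\<delta>(t))\<close> iff some
  bag in \<open>L(\<delta>(t))\<close> satisfies linear inequalities in the multiplicities, so polynomially many
  existential integer variables express this. An Ehrenfeucht-Fraisse argument as for Presburger
  arithmetic shows that multiplicity vectors which agree on the signs of all linear forms with
  doubly exponential coefficients, and modulo a triply exponential number, behave alike. Every
  class of this equivalence has a triply exponential member.
\<close>

section \<open>Integer vectors indistinguishable by small linear forms\<close>

text \<open>Merging nodes by their maximal types alone would fail for \<open>K\<close>: maximal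
  typings are greatest fixpoints, so when the nodes of a chain are merged although its end refutes a
  type, the resulting loop may let that type support itself. Recording stages keeps the refutation
  well-founded.

  Shrinking multiplicities must preserve failed matches as well as successful ones, so a small
  solution of an existential system is not enough; a symmetric equivalence settles both. The
  obstacle is that a kind has exponentially many multiplicities. As free variables they are
  harmless, but each quantified variable roughly squares the coefficients to be controlled, and
  assigning types edge by edge would quantify over exponentially many. Hall's theorem trades that
  assignment for exponentially many inequalities, which cost nothing because the equivalence
  preserves each form separately. What remains quantified are the counts in one bag per
  subexpression and the exponents of nested repetitions.\<close>

text \<open>Letting the constant \<open>e\<close> range over \<open>[-M, M]\<close> makes the two
  vectors agree on the exact value of every admissible form whose absolute value is below
  \<open>M\<close>. The same \<open>M\<close> serves as modulus because the extension step enlarges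
  both by one factor.\<close>

definition lsim :: "int \<Rightarrow> int \<Rightarrow> nat \<Rightarrow> (nat \<Rightarrow> int) \<Rightarrow> (nat \<Rightarrow> int) \<Rightarrow> bool" where
  "lsim a M n x y \<longleftrightarrow>
     (\<forall>f e. (\<forall>i<n. \<bar>f i\<bar> \<le> a) \<longrightarrow> \<bar>e\<bar> \<le> M \<longrightarrow>
        (0 \<le> (\<Sum>i<n. f i * x i) + e \<longleftrightarrow> 0 \<le> (\<Sum>i<n. f i * y i) + e)) \<and>
     (\<forall>i<n. M dvd x i - y i)"

lemma lsimD:
  assumes "lsim a M n x y" "\<And>i. i < n \<Longrightarrow> \<bar>f i\<bar> \<le> a" "\<bar>e\<bar> \<le> M"
  shows "0 \<le> (\<Sum>i<n. f i * x i) + e \<longleftrightarrow> 0 \<le> (\<Sum>i<n. f i * y i) + e"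
  using assms unfolding lsim_def by blast

lemma lsim_dvd: "lsim a M n x y \<Longrightarrow> i < n \<Longrightarrow> M dvd x i - y i"
  by (auto simp: lsim_def)

lemma lsim_refl: "lsim a M n x x"
  by (simp add: lsim_def)

lemma lsim_sym: "lsim a M n x y \<Longrightarrow> lsim a M n y x"
  unfolding lsim_def by (auto simp: dvd_diff_commute)

lemma lsim_trans: "lsim a M n x y \<Longrightarrow> lsim a M n y z \<Longrightarrow> lsim a M n x z"
  unfolding lsim_def
  by (intro conjI allI impI) (simp, metis diff_add_cancel add_diff_eq dvd_add)

lemma lsim_mono:
  assumes "lsim a' M' n x y" "a \<le> a'" "M dvd M'" "M \<le> M'"
  shows "lsim a M n x y"
  unfolding lsim_def
proof (intro conjI allI impI)
  fix f :: "nat \<Rightarrow> int" and e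
  assume "\<forall>i<n. \<bar>f i\<bar> \<le> a" "\<bar>e\<bar> \<le> M"
  then show "0 \<le> (\<Sum>i<n. f i * x i) + e \<longleftrightarrow> 0 \<le> (\<Sum>i<n. f i * y i) + e"
    using assms by (intro lsimD[OF assms(1)]) (auto intro: order_trans)
next
  fix i assume "i < n"
  then show "M dvd x i - y i" using lsim_dvd[OF assms(1)] assms(3) dvd_trans by blast
qed

lemma lsim_cong:
  assumes "lsim a M n x y" "\<And>i. i < n \<Longrightarrow> x i = x' i" "\<And>i. i < n \<Longrightarrow> y i = y' i"
  shows "lsim a M n x' y'"
  using assms unfolding lsim_def by simp

text \<open>Absorbs the constants arising in \<open>lsim_extend\<close> into the factorial that
  divisibility forces there anyway. It is an equality at 4.\<close>

lemma square_le_fact: "4 \<le> n \<Longrightarrow> 2 * n + n ^ 2 \<le> (fact n :: nat)"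
proof (induction n rule: nat_induct_at_least)
  case base show ?case by (simp add: fact_numeral)
next
  case (Suc n)
  have "2 * Suc n + Suc n ^ 2 \<le> Suc n * (2 * n + n ^ 2)"
  proof -
    have "4 * n \<le> n * n" using Suc.hyps by simp
    moreover have "n * n \<le> n * (n * n)" using Suc.hyps by simp
    moreover have "2 * Suc n + Suc n ^ 2 = 3 + 4 * n + n * n"
      "Suc n * (2 * n + n ^ 2) = 2 * n + 3 * (n * n) + n * (n * n)"
      by (simp_all add: power2_eq_square algebra_simps)
    ultimately show ?thesis using Suc.hyps by linarith
  qed
  also have "\<dots> \<le> fact (Suc n)"
    using mult_le_mono2[OF Suc.IH, of "Suc n"] by simp
  finally show ?case .
qed

text \<open>A value at minimal distance from 0 among the equivalent ones cannot be moved by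
  \<open>\<plusminus>M\<close>, hence lies close to the root of some admissible form.\<close>

lemma lsim_near_form:
  assumes "1 \<le> a" "1 \<le> M"
  obtains s' d f e where "lsim a M (Suc n) (x(n := s)) (x(n := s'))"
    "d \<noteq> 0" "\<bar>d\<bar> \<le> a" "\<And>i. i < n \<Longrightarrow> \<bar>f i\<bar> \<le> a" "\<bar>e\<bar> \<le> M"
    "\<bar>(\<Sum>i<n. f i * x i) + d * s' + e\<bar> \<le> a * M"
proof -
  let ?P = "\<lambda>s'. lsim a M (Suc n) (x(n := s)) (x(n := s'))"
  obtain s' where s': "?P s'" and min: "\<And>t. ?P t \<Longrightarrow> nat \<bar>s'\<bar> \<le> nat \<bar>t\<bar>"
    using ex_has_least_nat[of ?P s "\<lambda>t. nat \<bar>t\<bar>"] lsim_refl by blast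
  show thesis
  proof (cases "\<bar>s'\<bar> < M")
    case True
    have "M \<le> a * M" using assms by (simp add: mult_le_cancel_right1)
    with True have "\<bar>s'\<bar> \<le> a * M" by linarith
    then show thesis
      using assms by (intro that[of s' 1 "\<lambda>_. 0" 0]) (use s' in auto)
  next
    case False
    define s'' where "s'' = s' - sgn s' * M"
    have "\<bar>s''\<bar> < \<bar>s'\<bar>" using False assms(2) by (auto simp: s''_def sgn_if)
    then have "\<not> ?P s''" using min[of s''] by auto
    then have "\<not> lsim a M (Suc n) (x(n := s')) (x(n := s''))" using s' lsim_trans by blast
    moreover have "M dvd (x(n := s')) i - (x(n := s'')) i" for i
      by (simp add: s''_def)
    ultimately obtain f e where f: "\<forall>i<Suc n. \<bar>f i\<bar> \<le> a" and e: "\<bar>e\<bar> \<le> M"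
      and ne: "(0 \<le> (\<Sum>i<Suc n. f i * (x(n := s')) i) + e) \<noteq>
        (0 \<le> (\<Sum>i<Suc n. f i * (x(n := s'')) i) + e)"
      unfolding lsim_def by blast
    have sums: "(\<Sum>i<Suc n. f i * (x(n := u)) i) = (\<Sum>i<n. f i * x i) + f n * u" for u
      by simp
    have ne': "(0 \<le> (\<Sum>i<n. f i * x i) + f n * s' + e) \<noteq>
        (0 \<le> (\<Sum>i<n. f i * x i) + f n * s'' + e)"
      using ne unfolding sums .
    then have nz: "f n \<noteq> 0" by auto
    have "\<bar>f n * s' - f n * s''\<bar> \<le> \<bar>f n\<bar> * M"
      using assms(2) by (auto simp: s''_def abs_mult sgn_if right_diff_distrib)
    also have "\<dots> \<le> a * M" using f assms(2) by (intro mult_right_mono) auto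
    finally have "\<bar>f n * s' - f n * s''\<bar> \<le> a * M" .
    with ne' have "\<bar>(\<Sum>i<n. f i * x i) + f n * s' + e\<bar> \<le> a * M" by linarith
    then show thesis using s' nz f e by (intro that[of s' "f n" f e]) auto
  qed
qed

text \<open>One round of the game. After replacing \<open>s\<close> by a value near the root of a
  form, the new coordinate obeys an equation \<open>d * s' = r - e - f.x\<close> with small
  \<open>r\<close>; the reply \<open>t\<close> solves the same equation for \<open>y\<close>,
  integrally since \<open>d\<close> divides \<open>fact a\<close>. Multiplying a form by
  \<open>\<bar>d\<bar>\<close> and substituting the equation eliminates the new coordinate:
  coefficients stay within \<open>2 * a^2\<close>, constants within
  \<open>M * (2 * a + a^2)\<close>.\<close>

lemma lsim_extend:
  assumes "4 \<le> a" "1 \<le> M" and sim: "lsim (2 * a\<^sup>2) (M * fact (nat a)) n x y"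
  obtains t where "lsim a M (Suc n) (x(n := s)) (y(n := t))"
proof -
  obtain s' d f e where s': "lsim a M (Suc n) (x(n := s)) (x(n := s'))"
    and d: "d \<noteq> 0" "\<bar>d\<bar> \<le> a" and f: "\<And>i. i < n \<Longrightarrow> \<bar>f i\<bar> \<le> a" and e: "\<bar>e\<bar> \<le> M"
    and near: "\<bar>(\<Sum>i<n. f i * x i) + d * s' + e\<bar> \<le> a * M"
    by (rule lsim_near_form[of a M n x s]) (use assms in auto)
  define r where "r = (\<Sum>i<n. f i * x i) + d * s' + e"
  have "nat \<bar>d\<bar> dvd fact (nat a)" using d by (intro dvd_fact) auto
  then have "int (nat \<bar>d\<bar>) dvd int (fact (nat a))" using of_nat_dvd_iff by blast
  then have "d dvd fact (nat a)" by simp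
  then have "M * d dvd M * fact (nat a)" by simp
  then have "M * d dvd x i - y i" if "i < n" for i
    using lsim_dvd[OF sim that] dvd_trans by blast
  then have "M * d dvd (\<Sum>i<n. f i * (x i - y i))" by (intro dvd_sum) auto
  then obtain q where "(\<Sum>i<n. f i * (x i - y i)) = M * d * q" ..
  then have q: "(\<Sum>i<n. f i * x i) - (\<Sum>i<n. f i * y i) = M * d * q"
    by (simp add: right_diff_distrib sum_subtractf)
  \<comment> \<open>The shift is a multiple of \<open>M\<close>, which keeps the congruence, and
    \<open>d\<close> times it is exactly the difference of the two values of
    \<open>f\<close>.\<close>
  define t where "t = s' + M * q"
  have ds: "d * s' = r - e - (\<Sum>i<n. f i * x i)" by (simp add: r_def)
  have dt: "d * t = r - e - (\<Sum>i<n. f i * y i)"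
    using q by (simp add: r_def t_def algebra_simps)
  have "lsim a M (Suc n) (x(n := s')) (y(n := t))"
    unfolding lsim_def
  proof (intro conjI allI impI)
    fix i assume "i < Suc n"
    have "M dvd M * fact (nat a)" by simp
    then have "M dvd x i - y i" if "i < n" using lsim_dvd[OF sim that] dvd_trans by blast
    then show "M dvd (x(n := s')) i - (y(n := t)) i"
      using \<open>i < Suc n\<close> by (cases "i = n") (auto simp: t_def)
  next
    fix g :: "nat \<Rightarrow> int" and c
    assume g: "\<forall>i<Suc n. \<bar>g i\<bar> \<le> a" and c: "\<bar>c\<bar> \<le> M"
    define h where "h i = \<bar>d\<bar> * g i - sgn d * g n * f i" for i
    define k where "k = \<bar>d\<bar> * c + sgn d * g n * (r - e)"
    have scale: "0 \<le> (\<Sum>i<Suc n. g i * (z(n := u)) i) + c \<longleftrightarrow> 0 \<le> (\<Sum>i<n. h i * z i) + k"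
      if du: "d * u = r - e - (\<Sum>i<n. f i * z i)" for z u
    proof -
      have "\<bar>d\<bar> * ((\<Sum>i<Suc n. g i * (z(n := u)) i) + c) =
          \<bar>d\<bar> * (\<Sum>i<n. g i * z i) + sgn d * g n * (d * u) + \<bar>d\<bar> * c"
        by (simp add: algebra_simps abs_sgn)
      also have "\<dots> = (\<Sum>i<n. h i * z i) + k"
        unfolding du by (simp add: h_def k_def algebra_simps sum_subtractf sum_distrib_left)
      finally have *: "\<bar>d\<bar> * ((\<Sum>i<Suc n. g i * (z(n := u)) i) + c) = (\<Sum>i<n. h i * z i) + k" .
      have "0 < \<bar>d\<bar>" using d by simp
      then show ?thesis unfolding *[symmetric] by (simp add: zero_le_mult_iff)
    qed
    have sg: "\<bar>sgn d * g n\<bar> \<le> a" using g d by (simp add: abs_mult abs_sgn_eq)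
    have hb: "\<bar>h i\<bar> \<le> 2 * a\<^sup>2" if "i < n" for i
    proof -
      have "\<bar>\<bar>d\<bar> * g i\<bar> \<le> a * a" using d g that assms by (auto simp: abs_mult intro!: mult_mono)
      moreover have "\<bar>sgn d * g n * f i\<bar> \<le> a * a"
        unfolding abs_mult[of "sgn d * g n"] using sg f[OF that] assms(1)
        by (intro mult_mono) auto
      ultimately show ?thesis by (simp add: h_def power2_eq_square)
    qed
    have kb: "\<bar>k\<bar> \<le> M * fact (nat a)"
    proof -
      have "\<bar>\<bar>d\<bar> * c\<bar> \<le> a * M" using d c assms by (auto simp: abs_mult intro!: mult_mono)
      moreover have "\<bar>r - e\<bar> \<le> a * M + M" using near e by (simp add: r_def)
      then have "\<bar>sgn d * g n * (r - e)\<bar> \<le> a * (a * M + M)"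
        unfolding abs_mult[of "sgn d * g n"] using sg assms(1) by (intro mult_mono) auto
      ultimately have "\<bar>k\<bar> \<le> M * (2 * a + a\<^sup>2)"
        by (simp add: k_def power2_eq_square algebra_simps)
      also have "int (2 * nat a + nat a ^ 2) \<le> int (fact (nat a))"
        using square_le_fact[of "nat a"] assms(1) by (simp only: of_nat_le_iff)
      then have "2 * a + a\<^sup>2 \<le> fact (nat a)" using assms(1) by simp
      then have "M * (2 * a + a\<^sup>2) \<le> M * fact (nat a)" using assms(2) by simp
      finally show ?thesis .
    qed
    show "0 \<le> (\<Sum>i<Suc n. g i * (x(n := s')) i) + c \<longleftrightarrow>
        0 \<le> (\<Sum>i<Suc n. g i * (y(n := t)) i) + c"
      unfolding scale[OF ds] scale[OF dt] by (rule lsimD[OF sim hb kb])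
  qed
  then show thesis using s' lsim_trans that by blast
qed

section \<open>Small representatives of an equivalence class\<close>

text \<open>Fraction-free Gaussian elimination of the last coordinate. If no row involves it, its
  unit vector lies in the kernel. Otherwise a pivot row eliminates it, and both alternatives lift
  back through that row. Elimination turns \<open>l\<close> into \<open>3 * l\<close> and
  \<open>w\<close> into \<open>w + 2 * l\<close>; the bases 4 and 8 absorb this growth together with
  the cost of back substitution.\<close>

lemma bounded_or_kernel_vector:
  fixes x :: "nat \<Rightarrow> int"
  assumes "\<And>r i. r \<in> R \<Longrightarrow> i < n \<Longrightarrow> \<bar>r i\<bar> \<le> 2 ^ l" "1 \<le> l"
    and "\<And>r. r \<in> R \<Longrightarrow> \<bar>\<Sum>i<n. r i * x i\<bar> \<le> 2 ^ w"
  shows "(\<forall>i<n. \<bar>x i\<bar> \<le> 2 ^ ((w + l) * 8 ^ n)) \<or>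
    (\<exists>h. (\<exists>i<n. h i \<noteq> 0) \<and> (\<forall>i<n. \<bar>h i\<bar> \<le> 2 ^ (l * 4 ^ n)) \<and>
       (\<forall>r\<in>R. (\<Sum>i<n. r i * h i) = 0))"
  using assms
proof (induction n arbitrary: R l w)
  case 0
  then show ?case by simp
next
  case (Suc n)
  show ?case
  proof (cases "\<exists>r\<in>R. r n \<noteq> 0")
    case False
    then show ?thesis
      by (intro disjI2 exI[of _ "\<lambda>i. if i = n then 1 else 0"]) auto
  next
    case True
    then obtain r where r: "r \<in> R" "r n \<noteq> 0" by blast
    \<comment> \<open>This combination with the pivot row vanishes at coordinate
      \<open>n\<close>.\<close>
    define el where "el s i = r n * s i - s n * r i" for s i
    have pow3: "(2::int) * (2 ^ l * 2 ^ l) \<le> 2 ^ (3 * l)"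
      using Suc.prems(2) by (simp flip: power_add power_Suc)
    have el_bound: "\<bar>el s i\<bar> \<le> 2 ^ (3 * l)" if "s \<in> R" "i < Suc n" for s i
    proof -
      have "\<bar>r n * s i\<bar> \<le> 2 ^ l * 2 ^ l" "\<bar>s n * r i\<bar> \<le> 2 ^ l * 2 ^ l"
        using Suc.prems(1) r that by (auto simp: abs_mult intro!: mult_mono)
      then show ?thesis using pow3 by (simp add: el_def)
    qed
    have el_sum: "(\<Sum>i<n. el s i * z i) =
        r n * (\<Sum>i<n. s i * z i) - s n * (\<Sum>i<n. r i * z i)" for s z
      by (simp add: el_def algebra_simps sum_subtractf sum_distrib_left)
    have el_tight: "\<bar>\<Sum>i<n. el s i * x i\<bar> \<le> 2 ^ (w + 2 * l)" if "s \<in> R" for s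
    proof -
      have "(\<Sum>i<n. el s i * x i) =
          r n * (\<Sum>i<Suc n. s i * x i) - s n * (\<Sum>i<Suc n. r i * x i)"
        unfolding el_sum by (simp add: algebra_simps)
      moreover have "\<bar>r n * (\<Sum>i<Suc n. s i * x i)\<bar> \<le> 2 ^ l * 2 ^ w"
        "\<bar>s n * (\<Sum>i<Suc n. r i * x i)\<bar> \<le> 2 ^ l * 2 ^ w"
        unfolding abs_mult using Suc.prems(1,3) r that by (auto intro!: mult_mono simp del: sum.lessThan_Suc)
      ultimately have "\<bar>\<Sum>i<n. el s i * x i\<bar> \<le> 2 ^ (w + l + 1)"
        by (simp add: power_add mult.commute)
      also have "(2::int) ^ (w + l + 1) \<le> 2 ^ (w + 2 * l)"
        using Suc.prems(2) by (intro power_increasing) auto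
      finally show ?thesis .
    qed
    have IH: "(\<forall>i<n. \<bar>x i\<bar> \<le> 2 ^ ((w + 2 * l + 3 * l) * 8 ^ n)) \<or>
      (\<exists>h. (\<exists>i<n. h i \<noteq> 0) \<and> (\<forall>i<n. \<bar>h i\<bar> \<le> 2 ^ (3 * l * 4 ^ n)) \<and>
         (\<forall>r\<in>el ` R. (\<Sum>i<n. r i * h i) = 0))"
      using el_bound el_tight Suc.prems(2) by (intro Suc.IH) auto
    have row: "\<bar>\<Sum>i<n. r i * z i\<bar> \<le> 2 ^ (n + l + k)"
      if "\<And>i. i < n \<Longrightarrow> \<bar>z i\<bar> \<le> 2 ^ k" for z k
    proof -
      have "\<bar>\<Sum>i<n. r i * z i\<bar> \<le> (\<Sum>i<n. \<bar>r i * z i\<bar>)" by (rule sum_abs)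
      also have "\<dots> \<le> (\<Sum>i<n. 2 ^ l * 2 ^ k)"
        using that Suc.prems(1) r(1) by (intro sum_mono) (auto simp: abs_mult intro!: mult_mono)
      also have "\<dots> \<le> 2 ^ n * (2 ^ l * 2 ^ k)"
        by (auto intro!: mult_right_mono)
      finally show ?thesis by (simp add: power_add mult.assoc)
    qed
    have n4: "l + n \<le> l * 4 ^ n"
    proof -
      have "Suc n \<le> 4 ^ n" by (induction n) auto
      then have "l * Suc n \<le> l * 4 ^ n" by (rule mult_le_mono2)
      moreover have "n \<le> l * n" using Suc.prems(2) by simp
      ultimately show ?thesis unfolding mult_Suc_right by linarith
    qed
    have "n < 4 ^ n" "n < 8 ^ n" by (induction n) auto
    from IH show ?thesis
    proof
      assume small: "\<forall>i<n. \<bar>x i\<bar> \<le> 2 ^ ((w + 2 * l + 3 * l) * 8 ^ n)"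
      define k where "k = (w + 2 * l + 3 * l) * 8 ^ n"
      have kw: "w + 5 * l \<le> k"
    proof -
      have "(w + 2 * l + 3 * l) * 1 \<le> k" unfolding k_def by (rule mult_le_mono2) simp
      then show ?thesis by simp
    qed
      have "\<bar>x n\<bar> \<le> \<bar>r n\<bar> * \<bar>x n\<bar>" using r(2) by (simp add: mult_le_cancel_right1 int_one_le_iff_zero_less)
      also have "\<dots> = \<bar>(\<Sum>i<Suc n. r i * x i) - (\<Sum>i<n. r i * x i)\<bar>" by (simp add: abs_mult)
      also have "\<dots> \<le> 2 ^ w + 2 ^ (n + l + k)"
        using Suc.prems(3)[OF r(1)] row[of x k] small by (simp add: k_def)
      also have "\<dots> \<le> 2 ^ (n + l + k) + 2 ^ (n + l + k)"
        using kw by (intro add_mono power_increasing) auto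
      also have "\<dots> = 2 ^ (n + l + k + 1)" by simp
      also have "\<dots> \<le> 2 ^ ((w + l) * 8 ^ Suc n)"
      proof (intro power_increasing)
        have "n + 1 \<le> l * 8 ^ n"
          using mult_le_mono[OF Suc.prems(2) Suc_leI[OF \<open>n < 8 ^ n\<close>]] by simp
        moreover have "l * 1 \<le> l * 8 ^ n" by (rule mult_le_mono2) simp
        moreover have "(w + l) * 8 ^ Suc n =
            (w + 2 * l + 3 * l) * 8 ^ n + 3 * (l * 8 ^ n) + 7 * (w * 8 ^ n)"
          by (simp add: algebra_simps)
        ultimately show "n + l + k + 1 \<le> (w + l) * 8 ^ Suc n"
          unfolding k_def by linarith
      qed simp
      finally have "\<bar>x n\<bar> \<le> 2 ^ ((w + l) * 8 ^ Suc n)" .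
      moreover have "(2::int) ^ k \<le> 2 ^ ((w + l) * 8 ^ Suc n)"
        by (intro power_increasing) (auto simp: k_def algebra_simps)
      ultimately show ?thesis using small unfolding k_def[symmetric]
        by (metis less_Suc_eq order_trans)
    next
      assume "\<exists>h. (\<exists>i<n. h i \<noteq> 0) \<and> (\<forall>i<n. \<bar>h i\<bar> \<le> 2 ^ (3 * l * 4 ^ n)) \<and>
         (\<forall>r\<in>el ` R. (\<Sum>i<n. r i * h i) = 0)"
      then obtain h where h: "\<exists>i<n. h i \<noteq> 0" "\<And>i. i < n \<Longrightarrow> \<bar>h i\<bar> \<le> 2 ^ (3 * l * 4 ^ n)"
        "\<And>s. s \<in> R \<Longrightarrow> (\<Sum>i<n. el s i * h i) = 0" by auto
      \<comment> \<open>Solving the pivot row for the last coordinate would divide by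
        \<open>r n\<close>; scaling the other coordinates by \<open>r n\<close> keeps the vector
        integral.\<close>
      define h' where "h' i = (if i = n then - (\<Sum>i<n. r i * h i) else r n * h i)" for i
      have sum_h': "(\<Sum>i<n. s i * h' i) = r n * (\<Sum>i<n. s i * h i)" for s
        by (simp add: h'_def sum_distrib_left mult_ac)
      have "(\<Sum>i<Suc n. s i * h' i) = 0" if "s \<in> R" for s
        using h(3)[OF that] unfolding el_sum by (simp add: sum_h') (simp add: h'_def)
      moreover have "\<exists>i<Suc n. h' i \<noteq> 0" using h(1) r(2) by (auto simp: h'_def)
      moreover have "\<bar>h' i\<bar> \<le> 2 ^ (l * 4 ^ Suc n)" if "i < Suc n" for i
      proof -
        have "\<bar>h' i\<bar> \<le> 2 ^ (n + l + 3 * l * 4 ^ n)"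
        proof (cases "i = n")
          case True
          then show ?thesis using row[of h] h(2) by (simp add: h'_def)
        next
          case False
          then have "\<bar>h' i\<bar> \<le> 2 ^ l * 2 ^ (3 * l * 4 ^ n)"
            using that h(2)[of i] Suc.prems(1)[OF r(1), of n] by (auto simp: h'_def abs_mult intro!: mult_mono)
          also have "\<dots> \<le> 2 ^ (n + l + 3 * l * 4 ^ n)"
            unfolding power_add[symmetric] by (intro power_increasing) auto
          finally show ?thesis .
        qed
        also have "(2::int) ^ (n + l + 3 * l * 4 ^ n) \<le> 2 ^ (l * 4 ^ Suc n)"
          using n4 by (intro power_increasing) (auto simp: algebra_simps)
        finally show ?thesis .
      qed
      ultimately show ?thesis by blast
    qed
  qed
qed

lemma measures_append_less:
  "(\<And>g. g \<in> set gs \<Longrightarrow> g a = g b) \<Longrightarrow> f a < f b \<Longrightarrow> (a, b) \<in> measures (gs @ f # hs)"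
  by (induction gs) auto

text \<open>In a lexicographically minimal equivalent vector the forms with a small value admit no
  small kernel vector, since adding a multiple of it would preserve the equivalence.\<close>

lemma lsim_small:
  fixes n :: nat
  assumes "1 \<le> l" "1 \<le> M" "M \<le> 2 ^ v"
  defines "w \<equiv> n + l + v + l * 4 ^ n + 1"
  obtains x' where "lsim (2 ^ l) M n x x'" "\<And>i. i < n \<Longrightarrow> \<bar>x' i\<bar> \<le> 2 ^ ((w + l) * 8 ^ n)"
proof -
  \<comment> \<open>Lexicographic order on absolute values: a kernel step changes many coordinates,
    and only the first one that changes has to shrink.\<close>
  define fs where "fs = map (\<lambda>i (z :: nat \<Rightarrow> int). nat \<bar>z i\<bar>) [0..<n]"
  obtain x' where x': "lsim (2 ^ l) M n x x'"
    and min: "\<And>z. (z, x') \<in> measures fs \<Longrightarrow> \<not> lsim (2 ^ l) M n x z"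
    using wf_measures[of fs, unfolded wf_eq_minimal, rule_format, of x "{z. lsim (2 ^ l) M n x z}"]
      lsim_refl by blast
  \<comment> \<open>The tight forms. The threshold \<open>2 ^ w\<close> dominates the change of any
    form under a small kernel step plus any admissible constant, so the other forms keep their
    sign.\<close>
  define R where "R = {r. (\<forall>i<n. \<bar>r i\<bar> \<le> (2 ^ l :: int)) \<and> \<bar>\<Sum>i<n. r i * x' i\<bar> \<le> 2 ^ w}"
  have False if h: "\<exists>i<n. h i \<noteq> 0" "\<forall>i<n. \<bar>h i\<bar> \<le> 2 ^ (l * 4 ^ n)"
    "\<forall>r\<in>R. (\<Sum>i<n. r i * h i) = 0" for h
  proof -
    define k where "k = (LEAST i. i < n \<and> h i \<noteq> 0)"
    have k: "k < n" "h k \<noteq> 0" using LeastI_ex[OF h(1)] by (auto simp: k_def)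
    have below: "h j = 0" if "j < k" for j
      using not_less_Least[of j "\<lambda>i. i < n \<and> h i \<noteq> 0"] that k(1) by (auto simp: k_def)
    \<comment> \<open>The sign moves coordinate \<open>k\<close> towards 0; the factor
      \<open>M\<close> keeps all congruences.\<close>
    define u where "u = sgn (x' k) * sgn (h k) * M"
    have u: "\<bar>u\<bar> \<le> M" using assms(2) by (simp add: u_def abs_mult abs_sgn_eq)
    define z where "z j = x' j - u * h j" for j
    have form_z: "(\<Sum>i<n. f i * z i) = (\<Sum>i<n. f i * x' i) - u * (\<Sum>i<n. f i * h i)" for f
      by (simp add: z_def algebra_simps sum_subtractf sum_distrib_left)
    have step: "\<bar>u * (\<Sum>i<n. f i * h i)\<bar> + M \<le> 2 ^ w" if f: "\<forall>i<n. \<bar>f i\<bar> \<le> 2 ^ l" for f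
    proof -
      have "\<bar>\<Sum>i<n. f i * h i\<bar> \<le> (\<Sum>i<n. \<bar>f i * h i\<bar>)" by (rule sum_abs)
      also have "\<dots> \<le> (\<Sum>i<n. 2 ^ l * 2 ^ (l * 4 ^ n))"
        using f h(2) by (intro sum_mono) (auto simp: abs_mult intro!: mult_mono)
      also have "\<dots> \<le> 2 ^ n * (2 ^ l * 2 ^ (l * 4 ^ n))"
        by (auto intro!: mult_right_mono)
      finally have "\<bar>u * (\<Sum>i<n. f i * h i)\<bar> \<le> M * (2 ^ n * (2 ^ l * 2 ^ (l * 4 ^ n)))"
        using u assms(2) by (auto simp: abs_mult intro!: mult_mono)
      also have "\<dots> \<le> 2 ^ v * (2 ^ n * (2 ^ l * 2 ^ (l * 4 ^ n)))"
        using assms(3) by (intro mult_right_mono) auto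
      also have "\<dots> = 2 ^ (n + l + v + l * 4 ^ n)" by (simp add: power_add mult_ac)
      finally have "\<bar>u * (\<Sum>i<n. f i * h i)\<bar> \<le> 2 ^ (n + l + v + l * 4 ^ n)" .
      moreover have "(2::int) ^ v \<le> 2 ^ (n + l + v + l * 4 ^ n)"
        by (intro power_increasing) auto
      moreover have "(2::int) ^ w = 2 * 2 ^ (n + l + v + l * 4 ^ n)" by (simp add: w_def)
      ultimately show ?thesis using assms(3) by linarith
    qed
    have "lsim (2 ^ l) M n x' z"
      unfolding lsim_def
    proof (intro conjI allI impI)
      fix i assume "i < n"
      show "M dvd x' i - z i" by (simp add: z_def u_def)
    next
      fix f :: "nat \<Rightarrow> int" and e assume f: "\<forall>i<n. \<bar>f i\<bar> \<le> 2 ^ l" and e: "\<bar>e\<bar> \<le> M"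
      show "0 \<le> (\<Sum>i<n. f i * x' i) + e \<longleftrightarrow> 0 \<le> (\<Sum>i<n. f i * z i) + e"
      proof (cases "f \<in> R")
        case True
        then show ?thesis using h(3) by (simp add: form_z)
      next
        case False
        then have "\<bar>\<Sum>i<n. f i * x' i\<bar> > 2 ^ w" using f by (simp add: R_def)
        then show ?thesis using step[OF f] e unfolding form_z by linarith
      qed
    qed
    then have "lsim (2 ^ l) M n x z" using x' lsim_trans by blast
    moreover have "(z, x') \<in> measures fs"
    proof -
      \<comment> \<open>The unit form at \<open>k\<close> does not vanish on \<open>h\<close>, hence
        it is not tight: \<open>\<bar>x' k\<bar>\<close> exceeds the step, which therefore cannot
        overshoot 0.\<close>
      define f :: "nat \<Rightarrow> int" where "f i = (if i = k then 1 else 0)" for i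
      have f: "\<forall>i<n. \<bar>f i\<bar> \<le> 2 ^ l" by (simp add: f_def)
      have f_sum: "(\<Sum>i<n. f i * y i) = y k" for y
        using k(1) by (simp add: f_def if_distrib[of "\<lambda>u. u * _"] cong: if_cong)
      have "f \<notin> R" using h(3) k(2) f_sum by metis
      then have "\<bar>x' k\<bar> > 2 ^ w" using f by (simp add: R_def f_sum)
      moreover have "\<bar>u * h k\<bar> \<le> 2 ^ w" using step[OF f] assms(2) by (simp add: f_sum)
      moreover have "u * h k = sgn (x' k) * (M * \<bar>h k\<bar>)"
        by (simp add: u_def abs_sgn mult_ac)
      moreover have "M * \<bar>h k\<bar> > 0" using k(2) assms(2) by simp
      ultimately have "\<bar>z k\<bar> < \<bar>x' k\<bar>" by (auto simp: z_def sgn_if split: if_splits)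
      then have less: "nat \<bar>z k\<bar> < nat \<bar>x' k\<bar>" by linarith
      have "[0..<n] = [0..<k] @ k # [Suc k..<n]"
        using k(1) by (metis le_add_same_cancel1 less_imp_le upt_add_eq_append upt_conv_Cons le_Suc_ex zero_le)
      then show ?thesis unfolding fs_def
        using less below by (auto simp: z_def intro!: measures_append_less)
    qed
    ultimately show False using min by blast
  qed
  then have "\<forall>i<n. \<bar>x' i\<bar> \<le> 2 ^ ((w + l) * 8 ^ n)"
    using bounded_or_kernel_vector[of R n l x' w] assms(1) unfolding R_def by blast
  then show thesis using x' that by blast
qed

section \<open>The hierarchy of equivalences, indexed by the number of rounds left\<close>

text \<open>Both recurrences are read off \<open>lsim_extend\<close> with \<open>a = 2 ^ e\<close>,
  since \<open>2 * (2 ^ e)^2 = 2 ^ (2 * e + 1)\<close>. Level 0 is what quantifier-free facts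
  require: coefficients up to \<open>2 ^ l\<close> and constants up to 1.\<close>

fun level_exp :: "nat \<Rightarrow> nat \<Rightarrow> nat" where
  "level_exp l 0 = l"
| "level_exp l (Suc j) = 2 * level_exp l j + 1"

fun level_mod :: "nat \<Rightarrow> nat \<Rightarrow> int" where
  "level_mod l 0 = 1"
| "level_mod l (Suc j) = level_mod l j * fact (2 ^ level_exp l j)"

definition sim :: "nat \<Rightarrow> nat \<Rightarrow> nat \<Rightarrow> (nat \<Rightarrow> int) \<Rightarrow> (nat \<Rightarrow> int) \<Rightarrow> bool" where
  "sim l j = lsim (2 ^ level_exp l j) (level_mod l j)"

lemma sim_sym: "sim l j n x y \<Longrightarrow> sim l j n y x"
  unfolding sim_def by (rule lsim_sym)

lemma level_mod_ge_1: "1 \<le> level_mod l j"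
  by (induction j) (auto simp: int_one_le_iff_zero_less)

lemma level_exp_ge: "l \<le> level_exp l j"
  by (induction j) auto

lemma sim_mono_Suc: "sim l (Suc j) n x y \<Longrightarrow> sim l j n x y"
  unfolding sim_def
proof (erule lsim_mono)
  show "(2::int) ^ level_exp l j \<le> 2 ^ level_exp l (Suc j)"
    by (intro power_increasing) auto
  show "level_mod l j \<le> level_mod l (Suc j)"
    using level_mod_ge_1[of l j] by (auto simp: mult_le_cancel_left1 int_one_le_iff_zero_less)
qed simp

lemma sim_mono: "sim l j n x y \<Longrightarrow> i \<le> j \<Longrightarrow> sim l i n x y"
  by (induction j) (auto simp: le_Suc_eq dest: sim_mono_Suc)

lemma sim_extend1:
  assumes "2 \<le> l" "sim l (Suc j) n x y"
  obtains t where "sim l j (Suc n) (x(n := s)) (y(n := t))"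
proof -
  have "4 \<le> (2::int) ^ level_exp l j"
    using power_increasing[of 2 "level_exp l j" "2::int"] assms(1) level_exp_ge[of l j] by simp
  moreover have "lsim (2 * (2 ^ level_exp l j)\<^sup>2) (level_mod l j * fact (nat (2 ^ level_exp l j))) n x y"
    using assms(2) unfolding sim_def level_exp.simps level_mod.simps power_add power_even_eq
    by (simp add: nat_power_eq mult.commute)
  ultimately show thesis
    using that level_mod_ge_1 unfolding sim_def by (blast elim: lsim_extend)
qed

text \<open>The entries of \<open>x'\<close> from \<open>n\<close> on are the moves of the
  challenger, those of \<open>y'\<close> the replies; each of the \<open>m\<close> rounds costs one
  level.\<close>

lemma sim_extend:
  assumes "2 \<le> l" "sim l (m + j) n x y" and x': "\<And>i. i < n \<Longrightarrow> x' i = x i"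
  shows "\<exists>y'. sim l j (n + m) x' y' \<and> (\<forall>i<n. y' i = y i)"
  using assms(2)
proof (induction m arbitrary: j)
  case 0
  then show ?case using x' by (intro exI[of _ y]) (auto simp: sim_def intro: lsim_cong)
next
  case (Suc m)
  then obtain y' where y': "sim l (Suc j) (n + m) x' y'" "\<forall>i<n. y' i = y i" by force
  obtain t where "sim l j (Suc (n + m)) (x'(n + m := x' (n + m))) (y'(n + m := t))"
    by (rule sim_extend1[OF assms(1) y'(1)])
  then have "sim l j (n + Suc m) x' (y'(n + m := t))" by simp
  moreover have "\<forall>i<n. (y'(n + m := t)) i = y i" using y'(2) by simp
  ultimately show ?case by blast
qed

lemma sim_form:
  assumes "sim l j n x y" "\<And>i. i < n \<Longrightarrow> \<bar>f i\<bar> \<le> 2 ^ l" "\<bar>e\<bar> \<le> 1"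
  shows "0 \<le> (\<Sum>i<n. f i * x i) + e \<longleftrightarrow> 0 \<le> (\<Sum>i<n. f i * y i) + e"
proof -
  have "lsim (2 ^ level_exp l 0) (level_mod l 0) n x y"
    using sim_mono[OF assms(1), of 0] by (simp add: sim_def)
  then show ?thesis using assms by (intro lsimD) auto
qed

text \<open>The three indices may coincide, in which case coefficients add up; hence the bound on
  the sum of the absolute values.\<close>

lemma sim_form3:
  assumes "sim l j n x y" "p < n" "q < n" "r < n" "\<bar>a\<bar> + \<bar>b\<bar> + \<bar>c\<bar> \<le> 2 ^ l" "\<bar>e\<bar> \<le> 1"
  shows "0 \<le> a * x p + b * x q + c * x r + e \<longleftrightarrow> 0 \<le> a * y p + b * y q + c * y r + e"
proof -
  define f where "f i = (if i = p then a else 0) + (if i = q then b else 0) + (if i = r then c else 0)" for i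
  have "(\<Sum>i<n. f i * z i) = a * z p + b * z q + c * z r" for z
    using assms(2-4) by (simp add: f_def distrib_right sum.distrib if_distrib[of "\<lambda>u. u * _"] cong: if_cong)
  moreover have "\<bar>f i\<bar> \<le> 2 ^ l" for i using assms(5) unfolding f_def by (smt (verit))
  ultimately show ?thesis using sim_form[OF assms(1), of f e] assms(6) by simp
qed

lemma sim_nonneg_iff: "sim l j n x y \<Longrightarrow> p < n \<Longrightarrow> 0 \<le> x p \<longleftrightarrow> 0 \<le> y p"
  using sim_form3[of l j n x y p p p 1 0 0 0] by simp

lemma sim_zero_iff: "sim l j n x y \<Longrightarrow> p < n \<Longrightarrow> x p = 0 \<longleftrightarrow> y p = 0"
  using sim_nonneg_iff[of l j n x y p] sim_form3[of l j n x y p p p "-1" 0 0 0] by auto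

lemma sim_eq_iff:
  assumes "2 \<le> l" "sim l j n x y" "p < n" "q < n"
  shows "x p = x q \<longleftrightarrow> y p = y q"
proof -
  have "4 \<le> (2::int) ^ l" using power_increasing[of 2 l "2::int"] assms(1) by simp
  then show ?thesis
    using assms sim_form3[of l j n x y p q q 1 "-1" 0 0] sim_form3[of l j n x y p q q "-1" 1 0 0]
    by auto
qed

lemma sim_add_iff:
  assumes "2 \<le> l" "sim l j n x y" "p < n" "q < n" "r < n"
  shows "x p = x q + x r \<longleftrightarrow> y p = y q + y r"
proof -
  have "4 \<le> (2::int) ^ l" using power_increasing[of 2 l "2::int"] assms(1) by simp
  then show ?thesis
    using assms sim_form3[of l j n x y p q r 1 "-1" "-1" 0] sim_form3[of l j n x y p q r "-1" 1 1 0]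
    by auto
qed

lemma sim_sum_le_iff:
  assumes "2 \<le> l" "sim l j n x y" "A \<subseteq> {..<n}" "B \<subseteq> {..<n}"
  shows "(\<Sum>i\<in>A. x i) \<le> (\<Sum>i\<in>B. x i) \<longleftrightarrow> (\<Sum>i\<in>A. y i) \<le> (\<Sum>i\<in>B. y i)"
proof -
  have l: "4 \<le> (2::int) ^ l" using power_increasing[of 2 l "2::int"] assms(1) by simp
  define f :: "nat \<Rightarrow> int" where "f i = (if i \<in> B then 1 else 0) - (if i \<in> A then 1 else 0)" for i
  have "(\<Sum>i<n. f i * z i) = (\<Sum>i\<in>B. z i) - (\<Sum>i\<in>A. z i)" for z
  proof -
    have *: "(\<Sum>i<n. if i \<in> C then z i else 0) = (\<Sum>i\<in>C. z i)" if "C \<subseteq> {..<n}" for C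
      using that by (simp add: sum.inter_restrict[symmetric] Int_absorb1)
    show ?thesis
      unfolding *[OF assms(3), symmetric] *[OF assms(4), symmetric] sum_subtractf[symmetric]
      by (intro sum.cong) (auto simp: f_def)
  qed
  moreover have "\<bar>f i\<bar> \<le> 2 ^ l" for i using l by (simp add: f_def)
  ultimately show ?thesis using sim_form[OF assms(2), of f 0] by simp
qed

section \<open>A weighted version of Hall's theorem\<close>

text \<open>Each of the \<open>x i\<close> units of supply \<open>i\<close> is spent on some element
  of \<open>S i\<close>. With edges as supplies, multiplicities as amounts and typed labels as
  elements, this is the language of a signature.\<close>

definition distr :: "'i set \<Rightarrow> ('i \<Rightarrow> 'a set) \<Rightarrow> ('i \<Rightarrow> nat) \<Rightarrow> 'a multiset set" where
  "distr I S x =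
     {y. \<exists>w. (\<forall>i\<in>I. size (w i) = x i \<and> set_mset (w i) \<subseteq> S i) \<and> y = (\<Sum>i\<in>I. w i)}"

definition confined :: "'i set \<Rightarrow> ('i \<Rightarrow> 'a set) \<Rightarrow> ('i \<Rightarrow> nat) \<Rightarrow> 'a set \<Rightarrow> nat" where
  "confined I S x U = (\<Sum>i\<in>I. if S i \<subseteq> U then x i else 0)"

definition size_in :: "'a multiset \<Rightarrow> 'a set \<Rightarrow> nat" where
  "size_in y U = size (filter_mset (\<lambda>u. u \<in> U) y)"

lemma size_in_sum: "size_in (\<Sum>i\<in>I. w i) U = (\<Sum>i\<in>I. size_in (w i) U)"
  unfolding size_in_def
  using sum_comp_morphism[of "\<lambda>y. size (filter_mset (\<lambda>u. u \<in> U) y)" w I] by (simp add: comp_def)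

lemma size_in_modular: "size_in y (U \<union> V) + size_in y (U \<inter> V) = size_in y U + size_in y V"
  unfolding size_in_def by (induction y) auto

lemma size_in_add_mset: "size_in (add_mset u y) U = (if u \<in> U then 1 else 0) + size_in y U"
  by (simp add: size_in_def)

lemma confined_decrease:
  assumes "finite I" "i \<in> I" "0 < x i"
  shows "confined I S x U = (if S i \<subseteq> U then 1 else 0) + confined I S (x(i := x i - 1)) U"
proof -
  have "confined I S z U = (if S i \<subseteq> U then z i else 0) + (\<Sum>j\<in>I - {i}. if S j \<subseteq> U then z j else 0)"
    for z unfolding confined_def using assms by (intro sum.remove)
  from this[of x] this[of "x(i := x i - 1)"] show ?thesis using assms(3) by (simp cong: if_cong)
qed

text \<open>Supply \<open>i\<close> becomes confined only in the union and is lost by neither side.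
  This surplus makes the inequality strict exactly when two tight sets jointly cover
  \<open>S i\<close>, which Hall's condition then excludes.\<close>

lemma confined_supermodular:
  assumes "finite I" "i \<in> I" "\<not> S i \<subseteq> U" "\<not> S i \<subseteq> V"
  shows "confined I S x U + confined I S x V + (if S i \<subseteq> U \<union> V then x i else 0) \<le>
    confined I S x (U \<union> V) + confined I S x (U \<inter> V)"
proof -
  have "(if S i \<subseteq> U \<union> V then x i else 0) = (\<Sum>j\<in>I. if j = i \<and> S i \<subseteq> U \<union> V then x i else 0)"
    using assms by auto
  moreover have "(if S j \<subseteq> U then x j else 0) + (if S j \<subseteq> V then x j else 0) +
      (if j = i \<and> S i \<subseteq> U \<union> V then x i else 0) \<le>
      (if S j \<subseteq> U \<union> V then x j else 0) + (if S j \<subseteq> U \<inter> V then x j else 0)" for j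
    using assms by auto
  ultimately show ?thesis
    unfolding confined_def by (simp only: sum.distrib[symmetric]) (intro sum_mono)
qed

text \<open>The induction step of the weighted Hall theorem. If no unit of supply \<open>i\<close> can be
  spent, every \<open>u \<in> S i\<close> lies in a tight set that does not contain \<open>S i\<close>; by supermodularity
  such sets are closed under union, so one of them contains \<open>S i\<close> after all.\<close>

lemma hall_step:
  assumes "finite I" "i \<in> I" "0 < x i" and hall: "\<And>U. confined I S x U \<le> size_in y U"
  obtains u where "u \<in> S i" "u \<in># y"
    "\<And>U. confined I S (x(i := x i - 1)) U \<le> size_in (y - {#u#}) U"
proof (rule ccontr)
  assume "\<not> thesis"
  then have no: "\<exists>U. \<not> confined I S (x(i := x i - 1)) U \<le> size_in (y - {#u#}) U"
    if "u \<in> S i" "u \<in># y" for u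
    using that \<open>\<And>u. \<lbrakk>u \<in> S i; u \<in># y; \<And>U. confined I S (x(i := x i - 1)) U \<le> size_in (y - {#u#}) U\<rbrakk> \<Longrightarrow> thesis\<close>
    by blast
  define good where "good U \<longleftrightarrow> size_in y U \<le> confined I S x U \<and> \<not> S i \<subseteq> U" for U
  have union: "good (U \<union> V)" if "good U" "good V" for U V
  proof -
    have "confined I S x U + confined I S x V + (if S i \<subseteq> U \<union> V then x i else 0) \<le>
      confined I S x (U \<union> V) + confined I S x (U \<inter> V)"
      using that assms(1,2) by (intro confined_supermodular) (auto simp: good_def)
    then show ?thesis
      using that hall[of "U \<union> V"] hall[of "U \<inter> V"] size_in_modular[of y U V] assms(3)
      unfolding good_def by (auto split: if_splits)
  qed
  \<comment> \<open>\<open>S i\<close> may be infinite. The complement of the support of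
    \<open>y\<close> covers all of it except finitely many elements, so finitely many unions
    suffice.\<close>
  have base: "good {u. u \<notin># y}"
  proof -
    have "size_in y {u. u \<notin># y} = 0" by (simp add: size_in_def multiset_eq_iff not_in_iff)
    then show ?thesis
      using hall[of "{u. u \<notin># y}"] confined_decrease[of I i x S "{u. u \<notin># y}"] assms(1-3)
      by (auto simp: good_def split: if_splits)
  qed
  have single: "\<exists>U. good U \<and> u \<in> U" if "u \<in> S i" "u \<in># y" for u
  proof -
    obtain U where U: "\<not> confined I S (x(i := x i - 1)) U \<le> size_in (y - {#u#}) U"
      using no \<open>u \<in> S i\<close> \<open>u \<in># y\<close> by blast
    have "size_in y U = (if u \<in> U then 1 else 0) + size_in (y - {#u#}) U"
      using size_in_add_mset[of u "y - {#u#}" U] that by simp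
    then have "good U \<and> u \<in> U"
      using U hall[of U] confined_decrease[of I i x S U] assms(1-3) that(1)
      by (auto simp: good_def split: if_splits)
    then show ?thesis ..
  qed
  have "\<exists>U. good U \<and> {u. u \<notin># y} \<union> X \<subseteq> U" if "finite X" "X \<subseteq> S i \<inter> set_mset y" for X
    using that
  proof (induction X)
    case empty
    then show ?case using base by auto
  next
    case (insert u X)
    then obtain U V where "good U" "{u. u \<notin># y} \<union> X \<subseteq> U" "good V" "u \<in> V"
      using single[of u] by auto
    then show ?case using union[of U V] by (intro exI[of _ "U \<union> V"]) auto
  qed
  from this[of "S i \<inter> set_mset y"] show False by (auto simp: good_def)
qed

text \<open>Supply confined to \<open>U\<close> has to land in \<open>U\<close>. Conversely, units
  are spent one at a time, each on an element whose removal preserves all the conditions.\<close>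

theorem distr_iff_hall:
  assumes "finite I"
  shows "y \<in> distr I S x \<longleftrightarrow>
    size y = (\<Sum>i\<in>I. x i) \<and> (\<forall>U. confined I S x U \<le> size_in y U)"
proof (intro iffI conjI allI)
  assume "y \<in> distr I S x"
  then obtain w where w: "\<And>i. i \<in> I \<Longrightarrow> size (w i) = x i" "\<And>i. i \<in> I \<Longrightarrow> set_mset (w i) \<subseteq> S i"
    and y: "y = (\<Sum>i\<in>I. w i)"
    unfolding distr_def by blast
  show "size y = (\<Sum>i\<in>I. x i)" using w(1) by (simp add: y)
  have "(if S i \<subseteq> U then x i else 0) \<le> size_in (w i) U" if "i \<in> I" for U i
  proof (cases "S i \<subseteq> U")
    case True
    then have "filter_mset (\<lambda>u. u \<in> U) (w i) = w i"
      using w(2)[OF that] by (auto simp: filter_mset_eq_conv)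
    then show ?thesis using w(1)[OF that] by (simp add: size_in_def)
  qed simp
  then show "confined I S x U \<le> size_in y U" for U
    unfolding confined_def y size_in_sum by (rule sum_mono)
next
  assume "size y = (\<Sum>i\<in>I. x i) \<and> (\<forall>U. confined I S x U \<le> size_in y U)"
  then show "y \<in> distr I S x"
  proof (induction "size y" arbitrary: x y)
    case 0
    then have "y = (\<Sum>i\<in>I. {#})" "\<forall>i\<in>I. x i = 0" using assms by auto
    then show ?case unfolding distr_def by (intro CollectI exI[of _ "\<lambda>_. {#}"]) auto
  next
    case (Suc n)
    then have "(\<Sum>i\<in>I. x i) \<noteq> 0" by simp
    then obtain i where i: "i \<in> I" "0 < x i" using sum.not_neutral_contains_not_neutral by blast
    define x' where "x' = x(i := x i - 1)"
    obtain u where u: "u \<in> S i" "u \<in># y"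
      and hall: "\<And>U. confined I S x' U \<le> size_in (y - {#u#}) U"
      unfolding x'_def by (rule hall_step[of I i x S y]) (use assms i Suc.prems in auto)
    have "(\<Sum>i\<in>I. x i) = 1 + (\<Sum>i\<in>I. x' i)"
      using confined_decrease[of I i x "\<lambda>_. {}" "{}"] assms i by (simp add: confined_def x'_def)
    then have "size (y - {#u#}) = (\<Sum>i\<in>I. x' i)"
      using Suc.prems u by (simp add: size_Diff_singleton)
    moreover have "n = size (y - {#u#})" using Suc.hyps u by (simp add: size_Diff_singleton)
    ultimately have "y - {#u#} \<in> distr I S x'" using Suc.hyps(1) hall by blast
    then obtain w where w: "\<And>j. j \<in> I \<Longrightarrow> size (w j) = x' j"
      "\<And>j. j \<in> I \<Longrightarrow> set_mset (w j) \<subseteq> S j" and y: "y - {#u#} = (\<Sum>j\<in>I. w j)"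
      unfolding distr_def by blast
    have "(\<Sum>j\<in>I. (w(i := add_mset u (w i))) j) = add_mset u (\<Sum>j\<in>I. w j)"
      using assms i(1) by (simp add: sum.remove[of I i])
    also have "\<dots> = y" using u(2) by (simp flip: y)
    finally have y': "y = (\<Sum>j\<in>I. (w(i := add_mset u (w i))) j)" by simp
    have "size ((w(i := add_mset u (w i))) j) = x j \<and> set_mset ((w(i := add_mset u (w i))) j) \<subseteq> S j"
      if "j \<in> I" for j
      using w[OF that] u(1) i(2) by (auto simp: x'_def split: if_splits)
    then show ?case unfolding distr_def using y' by blast
  qed
qed

section \<open>Regular bag expressions\<close>

lemma bag_concI: "v \<in> A \<Longrightarrow> w \<in> B \<Longrightarrow> v + w \<in> bag_conc A B"
  by (auto simp: bag_conc_def)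

lemma bag_concE:
  assumes "u \<in> bag_conc A B"
  obtains v w where "u = v + w" "v \<in> A" "w \<in> B"
  using assms by (auto simp: bag_conc_def)

lemma bag_power_add:
  "v \<in> bag_power A i \<Longrightarrow> w \<in> bag_power A j \<Longrightarrow> v + w \<in> bag_power A (i + j)"
proof (induction i arbitrary: v)
  case (Suc i)
  then obtain a v' where "v = a + v'" "a \<in> A" "v' \<in> bag_power A i" by (auto elim: bag_concE)
  then show ?case using Suc.IH[of v'] Suc.prems(2) by (simp add: add.assoc bag_concI)
qed simp

lemma bag_power_split:
  "u \<in> bag_power A (i + j) \<Longrightarrow> \<exists>v w. u = v + w \<and> v \<in> bag_power A i \<and> w \<in> bag_power A j"
proof (induction i arbitrary: u)
  case (Suc i)
  then obtain a u' where u: "u = a + u'" "a \<in> A" "u' \<in> bag_power A (i + j)"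
    by (auto elim: bag_concE)
  then obtain v w where "u' = v + w" "v \<in> bag_power A i" "w \<in> bag_power A j"
    using Suc.IH by blast
  then show ?case using u by (intro exI[of _ "a + v"] exI[of _ w]) (auto simp: add.assoc bag_concI)
qed simp

text \<open>Since bags commute, the \<open>z\<close> factors can be sorted by their origin. Together
  with the corresponding facts for concatenation and repetition, this reduces a power of a compound
  expression to powers of its parts, with only exponents and bags as new unknowns.\<close>

lemma bag_power_union:
  "u \<in> bag_power (A \<union> B) z \<longleftrightarrow>
    (\<exists>i j v w. z = i + j \<and> u = v + w \<and> v \<in> bag_power A i \<and> w \<in> bag_power B j)"
proof
  assume "u \<in> bag_power (A \<union> B) z"
  then show "\<exists>i j v w. z = i + j \<and> u = v + w \<and> v \<in> bag_power A i \<and> w \<in> bag_power B j"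
  proof (induction z arbitrary: u)
    case (Suc z)
    then obtain a u' where u: "u = a + u'" "a \<in> A \<union> B" "u' \<in> bag_power (A \<union> B) z"
      by (auto elim: bag_concE)
    then obtain i j v w where *: "z = i + j" "u' = v + w" "v \<in> bag_power A i" "w \<in> bag_power B j"
      using Suc.IH by blast
    from u(2) show ?case
    proof
      assume "a \<in> A"
      then show ?thesis using u(1) *
        by (intro exI[of _ "Suc i"] exI[of _ j] exI[of _ "a + v"] exI[of _ w])
          (auto simp: add.assoc bag_concI)
    next
      assume "a \<in> B"
      then show ?thesis using u(1) *
        by (intro exI[of _ i] exI[of _ "Suc j"] exI[of _ v] exI[of _ "a + w"])
          (auto simp: add_ac bag_concI)
    qed
  qed auto
next
  assume "\<exists>i j v w. z = i + j \<and> u = v + w \<and> v \<in> bag_power A i \<and> w \<in> bag_power B j"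
  then obtain i j v w where *: "z = i + j" "u = v + w" "v \<in> bag_power A i" "w \<in> bag_power B j"
    by blast
  have "v \<in> bag_power (A \<union> B) i" "w \<in> bag_power (A \<union> B) j"
    using *(3,4) bag_power_mono[of A "A \<union> B" i] bag_power_mono[of B "A \<union> B" j] by auto
  then show "u \<in> bag_power (A \<union> B) z" using *(1,2) by (simp add: bag_power_add)
qed

lemma bag_power_conc:
  "u \<in> bag_power (bag_conc A B) z \<longleftrightarrow>
    (\<exists>v w. u = v + w \<and> v \<in> bag_power A z \<and> w \<in> bag_power B z)"
proof (induction z arbitrary: u)
  case (Suc z)
  show ?case
  proof
    assume "u \<in> bag_power (bag_conc A B) (Suc z)"
    then obtain a b u' where u: "u = a + b + u'" "a \<in> A" "b \<in> B" "u' \<in> bag_power (bag_conc A B) z"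
      by (auto elim!: bag_concE)
    then obtain v w where "u' = v + w" "v \<in> bag_power A z" "w \<in> bag_power B z"
      using Suc.IH by blast
    then show "\<exists>v w. u = v + w \<and> v \<in> bag_power A (Suc z) \<and> w \<in> bag_power B (Suc z)"
      using u by (intro exI[of _ "a + v"] exI[of _ "b + w"]) (auto simp: add_ac bag_concI)
  next
    assume "\<exists>v w. u = v + w \<and> v \<in> bag_power A (Suc z) \<and> w \<in> bag_power B (Suc z)"
    then obtain a b v w where u: "u = (a + v) + (b + w)" "a \<in> A" "b \<in> B"
      "v \<in> bag_power A z" "w \<in> bag_power B z"
      by (auto elim!: bag_concE)
    then have "v + w \<in> bag_power (bag_conc A B) z" using Suc.IH by blast
    then have "(a + b) + (v + w) \<in> bag_power (bag_conc A B) (Suc z)"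
      using u by (simp add: bag_concI)
    then show "u \<in> bag_power (bag_conc A B) (Suc z)" using u(1) by (simp add: add_ac)
  qed
qed simp

text \<open>\<open>z'\<close> is a sum of \<open>z\<close> elements of \<open>I\<close>; the last clause matters for \<open>hi I = \<infinity>\<close>.\<close>

definition interval_mult :: "interval \<Rightarrow> nat \<Rightarrow> nat \<Rightarrow> bool" where
  "interval_mult I z z' \<longleftrightarrow>
     lo I * z \<le> z' \<and> (\<forall>m. hi I = enat m \<longrightarrow> z' \<le> m * z) \<and> (z = 0 \<longrightarrow> z' = 0)"

lemma interval_mult_Suc:
  "i \<in> interval_set I \<Longrightarrow> interval_mult I z z' \<Longrightarrow> interval_mult I (Suc z) (i + z')"
  unfolding interval_mult_def interval_set_def by (auto intro: add_mono)

lemma interval_mult_split: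
  assumes wf: "wf_interval I" and mult: "interval_mult I (Suc z) z'"
  obtains i where "i \<in> interval_set I" "i \<le> z'" "interval_mult I z (z' - i)"
proof (cases "hi I")
  case (enat m)
  \<comment> \<open>The least element of the interval that leaves at most \<open>m * z\<close> for
    the remaining \<open>z\<close> summands.\<close>
  let ?i = "max (lo I) (z' - m * z)"
  have lo: "lo I * z \<le> m * z" "lo I \<le> m"
    using wf enat by (auto simp: wf_interval_def)
  then have "lo I + lo I * z \<le> z'" "z' \<le> m + m * z"
    using mult enat by (auto simp: interval_mult_def)
  moreover from this have "lo I * z \<le> z' - ?i" "z' - ?i \<le> m * z" "?i \<le> m" "?i \<le> z'"
    using lo by linarith+
  ultimately show thesis
    using lo enat by (intro that[of ?i]) (auto simp: interval_set_def interval_mult_def)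
next
  case infinity
  \<comment> \<open>Without an upper bound every summand but the last can be \<open>lo I\<close>;
    the last one absorbs the surplus.\<close>
  show thesis
  proof (cases "z = 0")
    case True
    then show thesis
      using mult infinity by (intro that[of z']) (auto simp: interval_set_def interval_mult_def)
  next
    case False
    then show thesis
      using mult infinity by (intro that[of "lo I"]) (auto simp: interval_set_def interval_mult_def)
  qed
qed

lemma bag_power_rep:
  assumes "wf_interval I"
  shows "u \<in> bag_power (\<Union>i\<in>interval_set I. bag_power A i) z \<longleftrightarrow>
    (\<exists>z'. interval_mult I z z' \<and> u \<in> bag_power A z')"
proof (induction z arbitrary: u)
  case 0
  then show ?case by (auto simp: interval_mult_def)
next
  case (Suc z)
  show ?case
  proof
    assume "u \<in> bag_power (\<Union>i\<in>interval_set I. bag_power A i) (Suc z)"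
    then obtain v w i where u: "u = v + w" "i \<in> interval_set I" "v \<in> bag_power A i"
      "w \<in> bag_power (\<Union>i\<in>interval_set I. bag_power A i) z"
      by (auto elim!: bag_concE)
    then obtain z' where "interval_mult I z z'" "w \<in> bag_power A z'" using Suc.IH by blast
    then show "\<exists>z'. interval_mult I (Suc z) z' \<and> u \<in> bag_power A z'"
      using u interval_mult_Suc bag_power_add by blast
  next
    assume "\<exists>z'. interval_mult I (Suc z) z' \<and> u \<in> bag_power A z'"
    then obtain z' where z': "interval_mult I (Suc z) z'" "u \<in> bag_power A z'" by blast
    obtain i where i: "i \<in> interval_set I" "i \<le> z'" "interval_mult I z (z' - i)"
      using interval_mult_split[OF assms z'(1)] by blast
    then obtain v w where "u = v + w" "v \<in> bag_power A i" "w \<in> bag_power A (z' - i)"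
      using bag_power_split[of u A i "z' - i"] z'(2) by auto
    then show "u \<in> bag_power (\<Union>i\<in>interval_set I. bag_power A i) (Suc z)"
      using i Suc.IH by (auto intro!: bag_concI)
  qed
qed

lemma bag_power_eps: "bag_power {{#}} z = {{#}}"
  by (induction z) (auto simp: bag_conc_def)

lemma bag_power_atoms: "bag_power {{#b#} | b. b \<in> S} k = {w. size w = k \<and> set_mset w \<subseteq> S}"
proof (induction k)
  case (Suc k)
  show ?case
  proof (intro equalityI subsetI)
    fix w assume "w \<in> {w. size w = Suc k \<and> set_mset w \<subseteq> S}"
    then have w: "size w = Suc k" "set_mset w \<subseteq> S" by auto
    then obtain b v where "w = add_mset b v" using size_eq_Suc_imp_eq_union by blast
    with w have "w = {#b#} + v" "b \<in> S" "v \<in> bag_power {{#b#} | b. b \<in> S} k"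
      using Suc.IH by auto
    moreover from this have "{#b#} + v \<in> bag_conc {{#b#} | b. b \<in> S} (bag_power {{#b#} | b. b \<in> S} k)"
      by (intro bag_concI) auto
    ultimately show "w \<in> bag_power {{#b#} | b. b \<in> S} (Suc k)" by simp
  qed (use Suc.IH in \<open>auto simp: bag_conc_def\<close>)
qed auto

lemma bag_power_atom: "bag_power {{#b#}} k = {replicate_mset k b}"
  by (induction k) (auto simp: bag_conc_def)

lemma set_mset_bag_power:
  "w \<in> bag_power A z \<Longrightarrow> (\<And>v. v \<in> A \<Longrightarrow> set_mset v \<subseteq> D) \<Longrightarrow> set_mset w \<subseteq> D"
proof (induction z arbitrary: w)
  case (Suc z)
  then obtain a v where "w = a + v" "a \<in> A" "v \<in> bag_power A z" by (auto elim: bag_concE)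
  then show ?case using Suc.IH[of v] Suc.prems(2) by auto
qed simp

lemma set_mset_rbe_lang: "rbe_over D E \<Longrightarrow> w \<in> rbe_lang E \<Longrightarrow> set_mset w \<subseteq> D"
proof (induction E arbitrary: w)
  case (Conc E F)
  then show ?case by (force elim!: bag_concE)
next
  case (Rep E I)
  then show ?case using set_mset_bag_power[of w "rbe_lang E" _ D] by auto
qed auto

section \<open>Membership in powers of a bag language as a property of integer vectors\<close>

definition encodes :: "'a set \<Rightarrow> ('a \<Rightarrow> nat) \<Rightarrow> (nat \<Rightarrow> int) \<Rightarrow> 'a multiset \<Rightarrow> bool" where
  "encodes D yv x w \<longleftrightarrow> set_mset w \<subseteq> D \<and> (\<forall>u\<in>D. int (count w u) = x (yv u))"

text \<open>The exponent is itself a variable. A subexpression below a repetition can then be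
  described once, by its power with an unknown exponent, instead of once per iteration.\<close>

definition sat :: "'a set \<Rightarrow> 'a rbe \<Rightarrow> ('a \<Rightarrow> nat) \<Rightarrow> nat \<Rightarrow> (nat \<Rightarrow> int) \<Rightarrow> bool" where
  "sat D E yv zv x \<longleftrightarrow>
     0 \<le> x zv \<and> (\<exists>w\<in>bag_power (rbe_lang E) (nat (x zv)). encodes D yv x w)"

lemma encodes_cong:
  "encodes D yv x w \<Longrightarrow> (\<And>u. u \<in> D \<Longrightarrow> x (yv u) = x' (yv' u)) \<Longrightarrow> encodes D yv' x' w"
  by (simp add: encodes_def)

lemma less_two_power_nbits: "k < 2 ^ nbits k"
proof (cases "k = 0")
  case False
  have "k < 2 ^ floorlog 2 k" using floorlog_bounds[of k 2] False by auto
  also have "(2::nat) ^ floorlog 2 k \<le> 2 ^ nbits k"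
    by (intro power_increasing) (auto simp: nbits_def)
  finally show ?thesis .
qed simp

text \<open>A block of fresh variables: the counts of two bags over \<open>D\<close> and two
  exponents, enough for any constructor. A uniform block size makes the number of rounds
  proportional to the size of the expression; a case with fewer witnesses pads the block with
  arbitrary values.\<close>

lemma sim_extend_witness:
  assumes "2 \<le> l" "inj_on idx D" "idx ` D \<subseteq> {..<k}" "sim l (2 * k + 2 + j) n x y"
  obtains x' y' where "sim l j (n + (2 * k + 2)) x' y'"
    "\<And>i. i < n \<Longrightarrow> x' i = x i" "\<And>i. i < n \<Longrightarrow> y' i = y i"
    "\<And>u. u \<in> D \<Longrightarrow> x' (n + idx u) = int (count v u)"
    "\<And>u. u \<in> D \<Longrightarrow> x' (n + k + idx u) = int (count w u)"
    "x' (n + 2 * k) = p" "x' (n + 2 * k + 1) = q"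
proof -
  define x' where "x' i = (if i < n then x i
    else if i < n + k then int (count v (inv_into D idx (i - n)))
    else if i < n + 2 * k then int (count w (inv_into D idx (i - n - k)))
    else if i = n + 2 * k then p else q)" for i
  have "idx u < k" "inv_into D idx (idx u) = u" if "u \<in> D" for u
    using that assms(2,3) by auto
  then have "\<And>u. u \<in> D \<Longrightarrow> x' (n + idx u) = int (count v u)"
    "\<And>u. u \<in> D \<Longrightarrow> x' (n + k + idx u) = int (count w u)"
    by (auto simp: x'_def)
  moreover obtain y' where "sim l j (n + (2 * k + 2)) x' y'" "\<forall>i<n. y' i = y i"
    using sim_extend[OF assms(1,4), of x'] by (auto simp: x'_def)
  ultimately show thesis by (intro that[of x' y']) (auto simp: x'_def)
qed

text \<open>The witnesses for \<open>x\<close> are played as fresh variables, the replies serve as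
  witnesses for \<open>y\<close>, and the linear relations linking them to the old variables carry
  over. Bounding the size by \<open>l\<close> makes interval bounds, written in binary, admissible
  as coefficients.\<close>

lemma sat_transfer:
  assumes "2 \<le> l" "inj_on idx D" "idx ` D \<subseteq> {..<k}"
    and "rbe_over D E" "rbe_size c E \<le> l" "sim l ((2 * k + 2) * rbe_size c E) n x y"
    and "yv ` D \<subseteq> {..<n}" "zv < n" "sat D E yv zv x"
  shows "sat D E yv zv y"
  using assms(4-)
proof (induction E arbitrary: n x y yv zv)
  case Empty
  then show ?case by simp
next
  case Eps
  have "y (yv u) = 0" if "u \<in> D" for u
    using sim_zero_iff[OF Eps.prems(3), of "yv u"] Eps.prems(4,6) that
    by (auto simp: sat_def encodes_def bag_power_eps)
  then show ?case
    using sim_nonneg_iff[OF Eps.prems(3)] Eps.prems(5,6)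
    by (auto simp: sat_def encodes_def bag_power_eps)
next
  case (Atom b)
  have x: "x (yv u) = (if u = b then x zv else 0)" if "u \<in> D" for u
    using Atom.prems(6) that by (auto simp: sat_def encodes_def bag_power_atom)
  have zv: "0 \<le> y zv" "b \<in> D"
    using sim_nonneg_iff[OF Atom.prems(3)] Atom.prems by (auto simp: sat_def)
  have "y (yv u) = (if u = b then y zv else 0)" if "u \<in> D" for u
    using sim_zero_iff[OF Atom.prems(3), of "yv u"]
      sim_eq_iff[OF assms(1) Atom.prems(3), of "yv u" zv] x[OF that] Atom.prems(4,5) that
    by (auto split: if_splits)
  then show ?case
    using zv by (auto simp: sat_def encodes_def bag_power_atom)
next
  case (Alt E F)
  obtain i j v w where x: "nat (x zv) = i + j" "v \<in> bag_power (rbe_lang E) i"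
    "w \<in> bag_power (rbe_lang F) j" "encodes D yv x (v + w)" "0 \<le> x zv"
    using Alt.prems(6) by (auto simp: sat_def bag_power_union)
  \<comment> \<open>One block is spent on splitting the bag and the exponent; both subexpressions
    then continue from the same extended vectors.\<close>
  have "sim l (2 * k + 2 + (2 * k + 2) * (rbe_size c E + rbe_size c F)) n x y"
    using Alt.prems(3) by (simp add: algebra_simps)
  then obtain x' y' where sim: "sim l ((2 * k + 2) * (rbe_size c E + rbe_size c F)) (n + (2 * k + 2)) x' y'"
    and old: "\<And>i. i < n \<Longrightarrow> x' i = x i" "\<And>i. i < n \<Longrightarrow> y' i = y i"
    and new: "\<And>u. u \<in> D \<Longrightarrow> x' (n + idx u) = int (count v u)"
    "\<And>u. u \<in> D \<Longrightarrow> x' (n + k + idx u) = int (count w u)"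
    "x' (n + 2 * k) = int i" "x' (n + 2 * k + 1) = int j"
    by (rule sim_extend_witness[OF assms(1-3), where v = v and w = w and p = "int i" and q = "int j"]) blast
  have idx: "u \<in> D \<Longrightarrow> idx u < k" for u using assms(3) by auto
  then have vars: "(\<lambda>u. n + idx u) ` D \<subseteq> {..<n + (2 * k + 2)}"
    "(\<lambda>u. n + k + idx u) ` D \<subseteq> {..<n + (2 * k + 2)}"
    by fastforce+
  have "sat D E (\<lambda>u. n + idx u) (n + 2 * k) y'"
  proof (rule Alt.IH(1)[where n = "n + (2 * k + 2)" and x = x'])
    show "sim l ((2 * k + 2) * rbe_size c E) (n + (2 * k + 2)) x' y'"
      by (rule sim_mono[OF sim], rule mult_le_mono2) simp
    show "sat D E (\<lambda>u. n + idx u) (n + 2 * k) x'"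
      using new x old Alt.prems(5) by (auto simp: sat_def encodes_def intro!: bexI[of _ v])
  qed (use Alt.prems vars in auto)
  moreover have "sat D F (\<lambda>u. n + k + idx u) (n + 2 * k + 1) y'"
  proof (rule Alt.IH(2)[where n = "n + (2 * k + 2)" and x = x'])
    show "sim l ((2 * k + 2) * rbe_size c F) (n + (2 * k + 2)) x' y'"
      by (rule sim_mono[OF sim], rule mult_le_mono2) simp
    show "sat D F (\<lambda>u. n + k + idx u) (n + 2 * k + 1) x'"
      using new x old Alt.prems(5) by (auto simp: sat_def encodes_def intro!: bexI[of _ w])
  qed (use Alt.prems vars in auto)
  ultimately obtain v' w' where v': "v' \<in> bag_power (rbe_lang E) (nat (y' (n + 2 * k)))"
    "encodes D (\<lambda>u. n + idx u) y' v'" "0 \<le> y' (n + 2 * k)"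
    and w': "w' \<in> bag_power (rbe_lang F) (nat (y' (n + 2 * k + 1)))"
    "encodes D (\<lambda>u. n + k + idx u) y' w'" "0 \<le> y' (n + 2 * k + 1)"
    unfolding sat_def by blast
  have "x' zv = x' (n + 2 * k) + x' (n + 2 * k + 1)" using x old new Alt.prems(5) by auto
  then have z: "y' zv = y' (n + 2 * k) + y' (n + 2 * k + 1)"
    by (subst (asm) sim_add_iff[OF assms(1) sim]) (use Alt.prems(5) in auto)
  have "y' (yv u) = y' (n + idx u) + y' (n + k + idx u)" if "u \<in> D" for u
  proof -
    have "yv u < n" using Alt.prems(4) that by auto
    then have "x' (yv u) = x' (n + idx u) + x' (n + k + idx u)"
      using x(4) old new that by (auto simp: encodes_def)
    then show ?thesis
      by (subst (asm) sim_add_iff[OF assms(1) sim]) (use \<open>yv u < n\<close> idx[OF that] in auto)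
  qed
  then have "encodes D yv y' (v' + w')" using v'(2) w'(2) by (auto simp: encodes_def)
  then have "encodes D yv y (v' + w')"
    by (rule encodes_cong) (use old Alt.prems(4) in auto)
  moreover have "nat (y zv) = nat (y' (n + 2 * k)) + nat (y' (n + 2 * k + 1))" "0 \<le> y zv"
    using z v'(3) w'(3) old Alt.prems(5) by auto
  moreover from this have "v' + w' \<in> bag_power (rbe_lang (Alt E F)) (nat (y zv))"
    using v'(1) w'(1) unfolding rbe_lang.simps bag_power_union by blast
  ultimately show ?case unfolding sat_def by blast
next
  case (Conc E F)
  obtain v w where x: "v \<in> bag_power (rbe_lang E) (nat (x zv))"
    "w \<in> bag_power (rbe_lang F) (nat (x zv))" "encodes D yv x (v + w)" "0 \<le> x zv"
    using Conc.prems(6) by (auto simp: sat_def bag_power_conc)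
  have "sim l (2 * k + 2 + (2 * k + 2) * (rbe_size c E + rbe_size c F)) n x y"
    using Conc.prems(3) by (simp add: algebra_simps)
  then obtain x' y' where sim: "sim l ((2 * k + 2) * (rbe_size c E + rbe_size c F)) (n + (2 * k + 2)) x' y'"
    and old: "\<And>i. i < n \<Longrightarrow> x' i = x i" "\<And>i. i < n \<Longrightarrow> y' i = y i"
    and new: "\<And>u. u \<in> D \<Longrightarrow> x' (n + idx u) = int (count v u)"
    "\<And>u. u \<in> D \<Longrightarrow> x' (n + k + idx u) = int (count w u)"
    by (rule sim_extend_witness[OF assms(1-3), where v = v and w = w and p = 0 and q = 0]) blast
  have idx: "u \<in> D \<Longrightarrow> idx u < k" for u using assms(3) by auto
  then have vars: "(\<lambda>u. n + idx u) ` D \<subseteq> {..<n + (2 * k + 2)}"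
    "(\<lambda>u. n + k + idx u) ` D \<subseteq> {..<n + (2 * k + 2)}"
    by fastforce+
  \<comment> \<open>Powers distribute over concatenation, so both parts keep the exponent variable
    \<open>zv\<close> and only the bag is split.\<close>
  have "sat D E (\<lambda>u. n + idx u) zv y'"
  proof (rule Conc.IH(1)[where n = "n + (2 * k + 2)" and x = x'])
    show "sim l ((2 * k + 2) * rbe_size c E) (n + (2 * k + 2)) x' y'"
      by (rule sim_mono[OF sim], rule mult_le_mono2) simp
    show "sat D E (\<lambda>u. n + idx u) zv x'"
      using new x old Conc.prems(5) by (auto simp: sat_def encodes_def intro!: bexI[of _ v])
  qed (use Conc.prems vars in auto)
  moreover have "sat D F (\<lambda>u. n + k + idx u) zv y'"
  proof (rule Conc.IH(2)[where n = "n + (2 * k + 2)" and x = x'])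
    show "sim l ((2 * k + 2) * rbe_size c F) (n + (2 * k + 2)) x' y'"
      by (rule sim_mono[OF sim], rule mult_le_mono2) simp
    show "sat D F (\<lambda>u. n + k + idx u) zv x'"
      using new x old Conc.prems(5) by (auto simp: sat_def encodes_def intro!: bexI[of _ w])
  qed (use Conc.prems vars in auto)
  ultimately obtain v' w' where v': "v' \<in> bag_power (rbe_lang E) (nat (y zv))"
    "encodes D (\<lambda>u. n + idx u) y' v'" "0 \<le> y zv"
    and w': "w' \<in> bag_power (rbe_lang F) (nat (y zv))"
    "encodes D (\<lambda>u. n + k + idx u) y' w'"
    unfolding sat_def using old(2)[OF Conc.prems(5)] by auto
  have "y' (yv u) = y' (n + idx u) + y' (n + k + idx u)" if "u \<in> D" for u
  proof -
    have "yv u < n" using Conc.prems(4) that by auto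
    then have "x' (yv u) = x' (n + idx u) + x' (n + k + idx u)"
      using x(3) old new that by (auto simp: encodes_def)
    then show ?thesis
      by (subst (asm) sim_add_iff[OF assms(1) sim]) (use \<open>yv u < n\<close> idx[OF that] in auto)
  qed
  then have "encodes D yv y' (v' + w')" using v'(2) w'(2) by (auto simp: encodes_def)
  then have "encodes D yv y (v' + w')"
    by (rule encodes_cong) (use old Conc.prems(4) in auto)
  moreover have "v' + w' \<in> bag_power (rbe_lang (Conc E F)) (nat (y zv))"
    using v'(1) w'(1) unfolding rbe_lang.simps bag_power_conc by blast
  ultimately show ?case using v'(3) unfolding sat_def by blast
next
  case (Rep E I)
  have wf: "wf_interval I" using Rep.prems(1) by simp
  obtain z' w where x: "interval_mult I (nat (x zv)) z'" "w \<in> bag_power (rbe_lang E) z'"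
    "encodes D yv x w" "0 \<le> x zv"
    using Rep.prems(6) by (auto simp: sat_def bag_power_rep[OF wf])
  have "sim l (2 * k + 2 + (2 * k + 2) * rbe_size c E) n x y"
    by (rule sim_mono[OF Rep.prems(3)]) (simp add: algebra_simps)
  then obtain x' y' where sim: "sim l ((2 * k + 2) * rbe_size c E) (n + (2 * k + 2)) x' y'"
    and old: "\<And>i. i < n \<Longrightarrow> x' i = x i" "\<And>i. i < n \<Longrightarrow> y' i = y i"
    and new: "x' (n + 2 * k) = int z'"
    by (rule sim_extend_witness[OF assms(1-3), where v = w and w = w and p = "int z'" and q = 0]) blast
  have "sat D E yv (n + 2 * k) y'"
  proof (rule Rep.IH[where n = "n + (2 * k + 2)" and x = x'])
    have "encodes D yv x' w"
      using x(3) by (rule encodes_cong) (use old Rep.prems(4) in auto)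
    then show "sat D E yv (n + 2 * k) x'" using x(2) new by (auto simp: sat_def)
  qed (use Rep.prems sim in auto)
  then obtain w' where w': "w' \<in> bag_power (rbe_lang E) (nat (y' (n + 2 * k)))"
    "encodes D yv y' w'" "0 \<le> y' (n + 2 * k)"
    unfolding sat_def by blast
  have "encodes D yv y w'"
    using w'(2) by (rule encodes_cong) (use old Rep.prems(4) in auto)
  have y: "0 \<le> y zv" using sim_nonneg_iff[OF Rep.prems(3)] Rep.prems(5) x(4) by blast
  have mod: "nbits (lo I) + 1 \<le> l"
    using Rep.prems(2) by (auto simp: interval_size_def nbits_def)
  \<comment> \<open>The extra 1 pays for the coefficient of the new exponent, which occurs in the
    same form as the interval bound.\<close>
  have bound: "int m + 1 \<le> 2 ^ l" if "nbits m \<le> l" for m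
  proof -
    have "m + 1 \<le> 2 ^ nbits m" using less_two_power_nbits[of m] by simp
    also have "\<dots> \<le> 2 ^ l" using that by (intro power_increasing) auto
    finally have "int (m + 1) \<le> int (2 ^ l)" by (simp only: of_nat_le_iff)
    then show ?thesis by simp
  qed
  have vars: "zv < n + (2 * k + 2)" "n + 2 * k < n + (2 * k + 2)" using Rep.prems(5) by auto
  have "interval_mult I (nat (y zv)) (nat (y' (n + 2 * k)))"
    unfolding interval_mult_def
  proof (intro conjI allI impI)
    have "int (lo I * nat (x zv)) \<le> int z'"
      using x(1) by (simp only: of_nat_le_iff interval_mult_def)
    then have "0 \<le> 1 * x' (n + 2 * k) + (- int (lo I)) * x' zv + 0 * x' zv + 0"
      using old(1)[OF Rep.prems(5)] new x(4) by simp
    then have "0 \<le> 1 * y' (n + 2 * k) + (- int (lo I)) * y' zv + 0 * y' zv + 0"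
      by (subst (asm) sim_form3[OF sim]) (use vars bound[of "lo I"] mod in auto)
    then have "int (lo I) * y zv \<le> y' (n + 2 * k)" using old(2)[OF Rep.prems(5)] by simp
    then have "int (lo I * nat (y zv)) \<le> int (nat (y' (n + 2 * k)))" using y by simp
    then show "lo I * nat (y zv) \<le> nat (y' (n + 2 * k))" by (simp only: of_nat_le_iff)
  next
    fix m assume m: "hi I = enat m"
    then have "nbits m \<le> l" using Rep.prems(2) by (simp add: interval_size_def)
    have "int z' \<le> int (m * nat (x zv))"
      using x(1) m by (simp only: of_nat_le_iff interval_mult_def)
    then have "0 \<le> (- 1) * x' (n + 2 * k) + int m * x' zv + 0 * x' zv + 0"
      using old(1)[OF Rep.prems(5)] new x(4) by simp
    then have "0 \<le> (- 1) * y' (n + 2 * k) + int m * y' zv + 0 * y' zv + 0"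
      by (subst (asm) sim_form3[OF sim]) (use vars bound[of m] \<open>nbits m \<le> l\<close> in auto)
    then have "y' (n + 2 * k) \<le> int m * y zv" using old(2)[OF Rep.prems(5)] by simp
    then have "int (nat (y' (n + 2 * k))) \<le> int (m * nat (y zv))" using y w'(3) by simp
    then show "nat (y' (n + 2 * k)) \<le> m * nat (y zv)" by (simp only: of_nat_le_iff)
  next
    assume "nat (y zv) = 0"
    then have "x zv = 0" using sim_zero_iff[OF Rep.prems(3,5)] y by simp
    then have "x' (n + 2 * k) = 0" using x(1) new by (simp add: interval_mult_def)
    then show "nat (y' (n + 2 * k)) = 0" using sim_zero_iff[OF sim vars(2)] by simp
  qed
  then have "w' \<in> bag_power (rbe_lang (Rep E I)) (nat (y zv))"
    using w'(1) unfolding rbe_lang.simps bag_power_rep[OF wf] by blast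
  then show ?case using y \<open>encodes D yv y w'\<close> unfolding sat_def by blast
qed

section \<open>Matching a signature with an expression\<close>

lemma size_in_eq_sum_count:
  assumes "finite D" "set_mset y \<subseteq> D"
  shows "size_in y U = (\<Sum>u\<in>U \<inter> D. count y u)"
proof -
  have "size_in y U = (\<Sum>u\<in>{u \<in> set_mset y. u \<in> U}. count y u)"
    by (simp add: size_in_def size_multiset_overloaded_eq)
  also have "\<dots> = (\<Sum>u\<in>U \<inter> D. count y u)"
    using assms by (intro sum.mono_neutral_left) (auto simp: not_in_iff)
  finally show ?thesis .
qed

text \<open>As all \<open>S i\<close> lie in \<open>D\<close>, intersecting \<open>U\<close> with
  \<open>D\<close> changes neither side of Hall's condition, so finitely many inequalities with
  coefficients in {-1, 0, 1} remain. The equality of sizes becomes one inequality, the other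
  direction being the case \<open>U = D\<close>.\<close>

lemma distr_iff_linear:
  assumes "finite D" "\<And>i. i < d \<Longrightarrow> S i \<subseteq> D" "inj_on yv D" "encodes D yv x y"
    and x: "\<And>i. i < d \<Longrightarrow> x i = int (z i)"
  shows "y \<in> distr {..<d} S z \<longleftrightarrow>
    (\<Sum>i\<in>yv ` D. x i) \<le> (\<Sum>i<d. x i) \<and>
    (\<forall>U\<subseteq>D. (\<Sum>i\<in>{i. i < d \<and> S i \<subseteq> U}. x i) \<le> (\<Sum>i\<in>yv ` U. x i))"
proof -
  have y: "set_mset y \<subseteq> D" "\<And>u. u \<in> D \<Longrightarrow> x (yv u) = int (count y u)"
    using assms(4) by (auto simp: encodes_def)
  have in_D: "(\<Sum>i\<in>yv ` U. x i) = int (size_in y U)" if "U \<subseteq> D" for U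
  proof -
    have "(\<Sum>i\<in>yv ` U. x i) = (\<Sum>u\<in>U. x (yv u))"
      by (simp add: sum.reindex[OF inj_on_subset[OF assms(3) that]])
    also have "\<dots> = (\<Sum>u\<in>U. int (count y u))" using y that by (intro sum.cong) auto
    also have "\<dots> = int (size_in y U)"
      using that by (simp add: size_in_eq_sum_count[OF assms(1) y(1)] Int_absorb2)
    finally show ?thesis .
  qed
  have "size_in y D = size y"
    using y(1) size_in_eq_sum_count[OF assms(1) y(1), of UNIV]
      size_in_eq_sum_count[OF assms(1) y(1), of D] by (simp add: size_in_def)
  then have size: "(\<Sum>i\<in>yv ` D. x i) = int (size y)" by (simp add: in_D)
  have total: "(\<Sum>i<d. x i) = int (\<Sum>i<d. z i)" using x by simp
  have conf: "(\<Sum>i\<in>{i. i < d \<and> S i \<subseteq> U}. x i) = int (confined {..<d} S z U)" for U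
  proof -
    have "(\<Sum>i\<in>{i. i < d \<and> S i \<subseteq> U}. x i) = (\<Sum>i\<in>{i \<in> {..<d}. S i \<subseteq> U}. int (z i))"
      using x by (intro sum.cong) auto
    also have "\<dots> = int (confined {..<d} S z U)"
      unfolding confined_def by (subst sum.inter_filter) (auto simp: if_distrib cong: if_cong)
    finally show ?thesis .
  qed
  have restrict: "(\<forall>U. confined {..<d} S z U \<le> size_in y U) \<longleftrightarrow>
      (\<forall>U\<subseteq>D. confined {..<d} S z U \<le> size_in y U)"
  proof (intro iffI allI impI)
    fix U assume *: "\<forall>U\<subseteq>D. confined {..<d} S z U \<le> size_in y U"
    have "confined {..<d} S z U = confined {..<d} S z (U \<inter> D)"
      unfolding confined_def using assms(2) by (intro sum.cong) auto
    moreover have "size_in y U = size_in y (U \<inter> D)"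
      by (simp add: size_in_eq_sum_count[OF assms(1) y(1)] Int_assoc)
    ultimately show "confined {..<d} S z U \<le> size_in y U" using * by auto
  qed blast
  have all: "confined {..<d} S z D = (\<Sum>i<d. z i)"
    unfolding confined_def using assms(2) by (intro sum.cong) auto
  have "y \<in> distr {..<d} S z \<longleftrightarrow>
      size y \<le> (\<Sum>i<d. z i) \<and> (\<forall>U\<subseteq>D. confined {..<d} S z U \<le> size_in y U)"
  proof -
    have "(\<Sum>i<d. z i) \<le> size y" if "\<forall>U\<subseteq>D. confined {..<d} S z U \<le> size_in y U"
      using that[rule_format, of D] by (simp add: all \<open>size_in y D = size y\<close>)
    then have "size y = (\<Sum>i<d. z i) \<and> (\<forall>U\<subseteq>D. confined {..<d} S z U \<le> size_in y U) \<longleftrightarrow>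
      size y \<le> (\<Sum>i<d. z i) \<and> (\<forall>U\<subseteq>D. confined {..<d} S z U \<le> size_in y U)"
      using order_antisym[of "size y" "\<Sum>i<d. z i"] order_refl[of "size y"] by argo
    then show ?thesis unfolding distr_iff_hall[OF finite_lessThan] restrict .
  qed
  moreover have "(\<forall>U\<subseteq>D. confined {..<d} S z U \<le> size_in y U) \<longleftrightarrow>
      (\<forall>U\<subseteq>D. (\<Sum>i\<in>{i. i < d \<and> S i \<subseteq> U}. x i) \<le> (\<Sum>i\<in>yv ` U. x i))"
    unfolding conf by (intro all_cong) (simp only: in_D of_nat_le_iff)
  ultimately show ?thesis unfolding size total of_nat_le_iff by (simp only:)
qed

text \<open>The \<open>d\<close> multiplicities are the free variables and do not enter the level.
  One block introduces the common bag and an exponent fixed to 1; the remaining rounds are for the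
  expression. Hall's conditions need no further rounds.\<close>

lemma match_transfer:
  assumes "2 \<le> l" "finite D" "rbe_over D E" "rbe_size c E \<le> l"
    and S: "\<And>i. i < d \<Longrightarrow> S i \<subseteq> D"
    and sim0: "sim l ((2 * card D + 2) * (rbe_size c E + 1)) d (\<lambda>i. int (z i)) (\<lambda>i. int (z' i))"
    and "distr {..<d} S z \<inter> rbe_lang E \<noteq> {}"
  shows "distr {..<d} S z' \<inter> rbe_lang E \<noteq> {}"
proof -
  let ?k = "card D"
  obtain y where y: "y \<in> distr {..<d} S z" "y \<in> rbe_lang E" using assms(7) by blast
  obtain idx where "bij_betw idx D {..<?k}"
    using ex_bij_betw_finite_nat[OF assms(2)] by (auto simp: lessThan_atLeast0)
  then have idx: "inj_on idx D" "idx ` D \<subseteq> {..<?k}" by (auto simp: bij_betw_def)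
  have "sim l (2 * ?k + 2 + (2 * ?k + 2) * rbe_size c E) d (\<lambda>i. int (z i)) (\<lambda>i. int (z' i))"
    using sim0 by (simp add: algebra_simps)
  then obtain x x' where sim: "sim l ((2 * ?k + 2) * rbe_size c E) (d + (2 * ?k + 2)) x x'"
    and old: "\<And>i. i < d \<Longrightarrow> x i = int (z i)" "\<And>i. i < d \<Longrightarrow> x' i = int (z' i)"
    and new: "\<And>u. u \<in> D \<Longrightarrow> x (d + idx u) = int (count y u)" "x (d + 2 * ?k) = 1"
    by (rule sim_extend_witness[OF assms(1) idx, where v = y and w = y and p = 1 and q = 0]) blast
  let ?yv = "\<lambda>u. d + idx u" and ?zv = "d + 2 * ?k" and ?n = "d + (2 * ?k + 2)"
  have vars: "?yv ` D \<subseteq> {..<?n}" "?zv < ?n" using idx(2) by fastforce+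
  have inj: "inj_on ?yv D" using idx(1) by (auto simp: inj_on_def)
  have y_D: "set_mset y \<subseteq> D" using set_mset_rbe_lang[OF assms(3) y(2)] .
  then have enc: "encodes D ?yv x y" using new(1) by (simp add: encodes_def)
  have pow1: "bag_power A 1 = A" for A :: "'a multiset set"
    by (auto simp: bag_conc_def)
  have "sat D E ?yv ?zv x"
    using enc y(2) new(2) pow1[of "rbe_lang E"] by (auto simp: sat_def)
  then have sat: "sat D E ?yv ?zv x'"
    by (rule sat_transfer[OF assms(1) idx assms(3,4) sim vars])
  \<comment> \<open>Comparing the exponent with 1 uses forms with constant 1 and -1, hence the range
    of \<open>e\<close> at level 0.\<close>
  have "4 \<le> (2::int) ^ l" using power_increasing[of 2 l "2::int"] assms(1) by simp
  then have "x' ?zv = 1"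
    using sim_form3[OF sim vars(2) vars(2) vars(2), of 1 0 0 "-1"]
      sim_form3[OF sim vars(2) vars(2) vars(2), of "-1" 0 0 1] new(2) by auto
  then obtain y' where y': "y' \<in> rbe_lang E" "encodes D ?yv x' y'"
    using sat pow1[of "rbe_lang E"] by (auto simp: sat_def)
  have "(\<Sum>i\<in>?yv ` D. x i) \<le> (\<Sum>i<d. x i) \<longleftrightarrow> (\<Sum>i\<in>?yv ` D. x' i) \<le> (\<Sum>i<d. x' i)"
    by (rule sim_sum_le_iff[OF assms(1) sim vars(1)]) auto
  moreover have "(\<Sum>i\<in>{i. i < d \<and> S i \<subseteq> U}. x i) \<le> (\<Sum>i\<in>?yv ` U. x i) \<longleftrightarrow>
      (\<Sum>i\<in>{i. i < d \<and> S i \<subseteq> U}. x' i) \<le> (\<Sum>i\<in>?yv ` U. x' i)" if "U \<subseteq> D" for U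
    by (rule sim_sum_le_iff[OF assms(1) sim]) (use vars(1) that in auto)
  moreover have "(\<Sum>i\<in>?yv ` D. x i) \<le> (\<Sum>i<d. x i) \<and>
    (\<forall>U\<subseteq>D. (\<Sum>i\<in>{i. i < d \<and> S i \<subseteq> U}. x i) \<le> (\<Sum>i\<in>?yv ` U. x i))"
    by (rule distr_iff_linear[THEN iffD1, OF assms(2) S inj enc old(1) y(1)])
  ultimately have "(\<Sum>i\<in>?yv ` D. x' i) \<le> (\<Sum>i<d. x' i) \<and>
    (\<forall>U\<subseteq>D. (\<Sum>i\<in>{i. i < d \<and> S i \<subseteq> U}. x' i) \<le> (\<Sum>i\<in>?yv ` U. x' i))"
    by simp
  moreover have "y' \<in> distr {..<d} S z' \<longleftrightarrow> (\<Sum>i\<in>?yv ` D. x' i) \<le> (\<Sum>i<d. x' i) \<and>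
    (\<forall>U\<subseteq>D. (\<Sum>i\<in>{i. i < d \<and> S i \<subseteq> U}. x' i) \<le> (\<Sum>i\<in>?yv ` U. x' i))"
    by (rule distr_iff_linear) (fact assms(2) S inj y'(2) old(2))+
  ultimately have "y' \<in> distr {..<d} S z'" by blast
  then show ?thesis using y'(1) by blast
qed

section \<open>The graph of kinds\<close>

lemma distr_reindex:
  assumes "finite B" "inj_on g B"
  shows "distr (g ` B) S x = distr B (\<lambda>b. S (g b)) (\<lambda>b. x (g b))"
proof -
  have "confined (g ` B) S x U = confined B (\<lambda>b. S (g b)) (\<lambda>b. x (g b)) U" for U
    by (simp add: confined_def sum.reindex[OF assms(2)])
  then show ?thesis
    using assms by (auto simp: distr_iff_hall sum.reindex)
qed

text \<open>Hall's conditions see only how much supply each allowed set has, so single edges with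
  equal allowed sets can be pooled into one multiplicity.\<close>

lemma distr_group:
  assumes "finite A" "finite B" "h ` A \<subseteq> B" "\<And>e. e \<in> A \<Longrightarrow> S e = S' (h e)"
  shows "distr A S (\<lambda>_. 1) = distr B S' (\<lambda>b. card {e \<in> A. h e = b})"
proof -
  have "confined A S (\<lambda>_. 1) U = confined B S' (\<lambda>b. card {e \<in> A. h e = b}) U" for U
  proof -
    have "confined A S (\<lambda>_. 1) U = (\<Sum>b\<in>B. \<Sum>e\<in>{e \<in> A. h e = b}. if S e \<subseteq> U then 1 else 0)"
      unfolding confined_def by (rule sum.group[OF assms(1-3), symmetric])
    also have "\<dots> = (\<Sum>b\<in>B. \<Sum>e\<in>{e \<in> A. h e = b}. if S' b \<subseteq> U then 1 else 0)"
      using assms(4) by (intro sum.cong) auto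
    also have "\<dots> = confined B S' (\<lambda>b. card {e \<in> A. h e = b}) U"
      unfolding confined_def by (intro sum.cong) auto
    finally show ?thesis .
  qed
  moreover have "(\<Sum>e\<in>A. 1) = (\<Sum>b\<in>B. card {e \<in> A. h e = b})"
    using sum.group[OF assms(1-3), of "\<lambda>_. 1 :: nat"] by simp
  ultimately show ?thesis using assms(1,2) by (auto simp: distr_iff_hall)
qed

text \<open>Exempting empty supplies matters for kinds: an edge of multiplicity 0 may lead to a kind
  whose types are not under control.\<close>

lemma distr_mono:
  assumes "\<And>i. i \<in> I \<Longrightarrow> 0 < x i \<Longrightarrow> S i \<subseteq> S' i"
  shows "distr I S x \<subseteq> distr I S' x"
proof
  fix y assume "y \<in> distr I S x"
  then obtain w where w: "\<forall>i\<in>I. size (w i) = x i \<and> set_mset (w i) \<subseteq> S i" "y = (\<Sum>i\<in>I. w i)"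
    unfolding distr_def by blast
  have "size (w i) = x i \<and> set_mset (w i) \<subseteq> S' i" if "i \<in> I" for i
  proof (cases "x i = 0")
    case True
    then show ?thesis using w(1) that by auto
  next
    case False
    then show ?thesis using w(1) that assms[OF that] by auto
  qed
  then show "y \<in> distr I S' x" unfolding distr_def using w(2) by blast
qed

lemma signature_distr:
  assumes "finite (edges G)" "finite T"
    and occ: "\<And>e. e \<in> out_edges G n \<Longrightarrow> occur G e = singleton_interval (k e)"
  shows "rbe_lang (signature G T n) =
    distr (out_edges G n) (\<lambda>e. {lab G e} \<times> T `` {target G e}) k"
proof -
  have "(\<Union>i\<in>interval_set (occur G e). bag_power {{#(lab G e, t)#} | t. (target G e, t) \<in> T} i) =
      {w. size w = k e \<and> set_mset w \<subseteq> {lab G e} \<times> T `` {target G e}}"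
    if "e \<in> out_edges G n" for e
  proof -
    have "interval_set (occur G e) = {k e}"
      using occ[OF that] by (auto simp: interval_set_def singleton_interval_def)
    moreover have "{{#(lab G e, t)#} | t. (target G e, t) \<in> T} =
        {{#b#} | b. b \<in> {lab G e} \<times> T `` {target G e}}"
      by auto
    ultimately show ?thesis by (simp only: bag_power_atoms UN_insert UN_empty Un_empty_right)
  qed
  then have "(\<forall>e\<in>out_edges G n. w e \<in> (\<Union>i\<in>interval_set (occur G e).
        bag_power {{#(lab G e, t)#} | t. (target G e, t) \<in> T} i)) \<longleftrightarrow>
      (\<forall>e\<in>out_edges G n. size (w e) = k e \<and> set_mset (w e) \<subseteq> {lab G e} \<times> T `` {target G e})"
    for w by (intro ball_cong) simp_all
  then show ?thesis
    unfolding signature_lang[OF assms(1,2)] distr_def by (simp only: conj_commute)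
qed

section \<open>The compressed graph of a system of kinds\<close>

text \<open>Edge \<open>e\<close> is slot \<open>e mod d\<close> of node \<open>e div d\<close>, and
  \<open>dec\<close> lists all pairs of label and target. Every possible edge is present exactly
  once, so parallel edges cannot arise, and absence is expressed by multiplicity 0.\<close>

definition kind_graph ::
    "nat \<Rightarrow> nat \<Rightarrow> (nat \<Rightarrow> 'l \<times> nat) \<Rightarrow> (nat \<Rightarrow> nat \<Rightarrow> nat) \<Rightarrow> 'l graph" where
  "kind_graph m d dec z =
     \<lparr>nodes = {..<m}, edges = {..<m * d}, source = (\<lambda>e. e div d),
      target = (\<lambda>e. snd (dec (e mod d))), lab = (\<lambda>e. fst (dec (e mod d))),
      occur = (\<lambda>e. singleton_interval (z (e div d) (e mod d)))\<rparr>"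

lemma kind_graph_index:
  assumes "e < m * (d :: nat)"
  shows "e div d < m" "e mod d < d"
  using assms by (auto simp: less_mult_imp_div_less) (metis mod_less_divisor mult_0_right not_less_zero neq0_conv)

lemma compressed_kind_graph:
  assumes dec: "bij_betw dec {..<d} (\<Sigma> \<times> {..<m})"
  shows "compressed_graph \<Sigma> (kind_graph m d dec z)"
proof -
  have "dec (e mod d) \<in> \<Sigma> \<times> {..<m}" if "e < m * d" for e
    using kind_graph_index[OF that] dec by (auto simp: bij_betw_def)
  then have range: "fst (dec (e mod d)) \<in> \<Sigma>" "snd (dec (e mod d)) < m" if "e < m * d" for e
    using that by (metis mem_Times_iff lessThan_iff)+
  have "inj_on (\<lambda>e. (e div d, snd (dec (e mod d)), fst (dec (e mod d)))) {..<m * d}"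
  proof (rule inj_onI)
    fix e e' assume e: "e \<in> {..<m * d}" "e' \<in> {..<m * d}"
      and eq: "(e div d, snd (dec (e mod d)), fst (dec (e mod d))) =
        (e' div d, snd (dec (e' mod d)), fst (dec (e' mod d)))"
    then have "dec (e mod d) = dec (e' mod d)" by (simp add: prod_eq_iff)
    then have "e mod d = e' mod d"
      using dec kind_graph_index(2) e by (auto simp: bij_betw_def dest: inj_onD)
    then show "e = e'" using eq by (metis div_mult_mod_eq prod.inject)
  qed
  then show ?thesis
    using range kind_graph_index
    by (auto simp: compressed_graph_def wf_graph_def kind_graph_def)
qed

lemma signature_kind_graph:
  assumes "n < m" "finite T"
  shows "rbe_lang (signature (kind_graph m d dec z) T n) =
    distr {..<d} (\<lambda>b. {fst (dec b)} \<times> T `` {snd (dec b)}) (z n)"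
proof -
  let ?G = "kind_graph m d dec z"
  have out: "out_edges ?G n = (\<lambda>b. n * d + b) ` {..<d}"
  proof (intro equalityI subsetI)
    fix e assume "e \<in> out_edges ?G n"
    then have "e < m * d" "e div d = n" by (auto simp: out_edges_def kind_graph_def)
    then have "e = n * d + e mod d" "e mod d < d" using kind_graph_index(2) div_mult_mod_eq by auto
    then show "e \<in> (\<lambda>b. n * d + b) ` {..<d}" by blast
  next
    fix e assume "e \<in> (\<lambda>b. n * d + b) ` {..<d}"
    then obtain b where b: "e = n * d + b" "b < d" by auto
    have "n * d + b < Suc n * d" using b(2) by simp
    also have "\<dots> \<le> m * d" using assms(1) by (intro mult_le_mono1) simp
    finally show "e \<in> out_edges ?G n" using b by (auto simp: out_edges_def kind_graph_def)
  qed
  have "rbe_lang (signature ?G T n) =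
      distr (out_edges ?G n) (\<lambda>e. {lab ?G e} \<times> T `` {target ?G e}) (\<lambda>e. z n (e mod d))"
    by (rule signature_distr) (use assms(2) in \<open>auto simp: kind_graph_def out_edges_def\<close>)
  also have "\<dots> = distr {..<d} (\<lambda>b. {fst (dec (b mod d))} \<times> T `` {snd (dec (b mod d))})
      (\<lambda>b. z n (b mod d))"
    unfolding out by (subst distr_reindex) (auto simp: inj_on_def kind_graph_def)
  also have "\<dots> = distr {..<d} (\<lambda>b. {fst (dec b)} \<times> T `` {snd (dec b)}) (z n)"
    unfolding distr_def by (auto intro!: arg_cong[where f = Collect] ext ex_cong1)
  finally show ?thesis .
qed

text \<open>Every type in the typing bound of a kind is refuted by kinds of smaller rank, which makes
  the bound hold for the (greatest) maximal typing.\<close>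

lemma kind_graph_counterexample:
  fixes \<Sigma> :: "'l set" and rank :: "nat \<Rightarrow> nat"
  assumes wf: "wf_schema \<Sigma> H" "wf_schema \<Sigma> K"
    and dec: "bij_betw dec {..<d} (\<Sigma> \<times> {..<m})"
    and types: "\<And>j. j < m \<Longrightarrow> \<tau>H j \<subseteq> types H" "\<And>j. j < m \<Longrightarrow> \<tau>H j \<noteq> {}"
    and j0: "j0 < m" "\<tau>K j0 = {}"
    and valid: "\<And>j t. j < m \<Longrightarrow> t \<in> \<tau>H j \<Longrightarrow>
      distr {..<d} (\<lambda>b. {fst (dec b)} \<times> \<tau>H (snd (dec b))) (z j) \<inter> rbe_lang (delta H t) \<noteq> {}"
    and invalid: "\<And>j t. j < m \<Longrightarrow> t \<in> types K - \<tau>K j \<Longrightarrow>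
      distr {..<d} (\<lambda>b. {fst (dec b)} \<times> \<tau>K (snd (dec b))) (z j) \<inter> rbe_lang (delta K t) = {}"
    and rank: "\<And>j b. j < m \<Longrightarrow> \<not> types K \<subseteq> \<tau>K j \<Longrightarrow> b < d \<Longrightarrow> 0 < z j b \<Longrightarrow>
      rank (snd (dec b)) < rank j"
  shows "satisfies (kind_graph m d dec z) H" "\<not> satisfies (kind_graph m d dec z) K"
proof -
  let ?G = "kind_graph m d dec z"
  have nodes: "nodes ?G = {..<m}" by (simp add: kind_graph_def)
  have wfG: "wf_graph \<Sigma> ?G"
    using compressed_kind_graph[OF dec] by (simp add: compressed_graph_def)
  have target: "snd (dec b) < m" if "b < d" for b
    using dec that by (auto simp: bij_betw_def) (metis imageI lessThan_iff mem_Times_iff)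
  define T where "T = (SIGMA j:{..<m}. \<tau>H j)"
  have "T \<subseteq> {..<m} \<times> types H" using types(1) by (auto simp: T_def)
  moreover from this have "finite T"
    by (rule finite_subset) (use wf(1) in \<open>simp add: wf_schema_def\<close>)
  moreover have "distr {..<d} (\<lambda>b. {fst (dec b)} \<times> T `` {snd (dec b)}) (z j) =
      distr {..<d} (\<lambda>b. {fst (dec b)} \<times> \<tau>H (snd (dec b))) (z j)" for j
    using target by (intro equalityI distr_mono) (auto simp: T_def)
  ultimately have "valid_typing ?G H T"
    using valid by (auto simp: valid_typing_def nodes signature_kind_graph T_def)
  then have "T \<subseteq> max_typing ?G H" using max_typing_greatest(2)[OF wfG wf(1)] by blast
  then show "satisfies ?G H"
    using types(2) by (fastforce simp: satisfies_def nodes T_def)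
  define M where "M = max_typing ?G K"
  have M: "valid_typing ?G K M" unfolding M_def by (rule max_typing_greatest(1)[OF wfG wf(2)])
  then have M_sub: "M \<subseteq> {..<m} \<times> types K" by (simp add: valid_typing_def nodes)
  then have "finite M" by (rule finite_subset) (use wf(2) in \<open>simp add: wf_schema_def\<close>)
  have "M `` {j} \<subseteq> \<tau>K j" if "j < m" for j
    using that
  proof (induction "rank j" arbitrary: j rule: less_induct)
    case less
    show ?case
    proof
      fix t assume t: "t \<in> M `` {j}"
      show "t \<in> \<tau>K j"
      proof (rule ccontr)
        assume "t \<notin> \<tau>K j"
        then have t': "t \<in> types K - \<tau>K j" using t M_sub by auto
        have "distr {..<d} (\<lambda>b. {fst (dec b)} \<times> M `` {snd (dec b)}) (z j) \<subseteq>
            distr {..<d} (\<lambda>b. {fst (dec b)} \<times> \<tau>K (snd (dec b))) (z j)"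
        proof (rule distr_mono)
          fix b assume b: "b \<in> {..<d}" "0 < z j b"
          \<comment> \<open>The refuted type \<open>t\<close> shows that kind \<open>j\<close> lacks
            a type of \<open>K\<close>, which is the condition under which ranks decrease along its
            edges.\<close>
          then have "rank (snd (dec b)) < rank j" using rank[OF less.prems] t' by auto
          then have "M `` {snd (dec b)} \<subseteq> \<tau>K (snd (dec b))" using less.hyps target b by simp
          then show "{fst (dec b)} \<times> M `` {snd (dec b)} \<subseteq> {fst (dec b)} \<times> \<tau>K (snd (dec b))"
            by blast
        qed
        moreover have "distr {..<d} (\<lambda>b. {fst (dec b)} \<times> M `` {snd (dec b)}) (z j) \<inter>
            rbe_lang (delta K t) \<noteq> {}"
        proof -
          have "rbe_lang (signature ?G M j) \<inter> rbe_lang (delta K t) \<noteq> {}"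
            using M t unfolding valid_typing_def by blast
          then show ?thesis unfolding signature_kind_graph[OF less.prems \<open>finite M\<close>] .
        qed
        ultimately show False using invalid[OF less.prems t'] by blast
      qed
    qed
  qed
  then show "\<not> satisfies ?G K"
    using j0 by (auto simp: satisfies_def nodes M_def)
qed

section \<open>Refinement stages and the kinds of a counterexample\<close>

fun stage :: "'l graph \<Rightarrow> 'l schema \<Rightarrow> nat \<Rightarrow> (nat \<times> nat) set" where
  "stage G S 0 = nodes G \<times> types S"
| "stage G S (Suc i) = {(n, t) \<in> nodes G \<times> types S.
     rbe_lang (signature G (stage G S i) n) \<inter> rbe_lang (delta S t) \<noteq> {}}"

lemma stage_subset: "stage G S i \<subseteq> nodes G \<times> types S"
  by (cases i) auto

lemma finite_stage:
  assumes "wf_graph \<Sigma> G" "wf_schema \<Sigma> S"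
  shows "finite (stage G S i)"
  by (rule finite_subset[OF stage_subset]) (use assms in \<open>simp add: wf_graph_def wf_schema_def\<close>)

lemma stage_decreasing:
  assumes "wf_graph \<Sigma> G" "wf_schema \<Sigma> S"
  shows "stage G S (Suc i) \<subseteq> stage G S i"
proof (induction i)
  case 0
  then show ?case by auto
next
  case (Suc i)
  have "rbe_lang (signature G (stage G S (Suc i)) n) \<subseteq> rbe_lang (signature G (stage G S i) n)" for n
    using Suc assms by (intro signature_mono finite_stage[OF assms]) (auto simp: wf_graph_def)
  then show ?case by (subst (1 2) stage.simps(2)) blast
qed

text \<open>A decreasing sequence of finite sets repeats a value, and a stage equal to its successor
  is a valid typing.\<close>

lemma stage_reaches_max_typing:
  assumes "wf_graph \<Sigma> G" "wf_schema \<Sigma> S"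
  obtains i where "stage G S i \<subseteq> max_typing G S"
proof -
  have "\<exists>i. stage G S (Suc i) = stage G S i"
  proof (rule ccontr)
    assume "\<not> ?thesis"
    then have "stage G S (Suc i) \<subset> stage G S i" for i
      using stage_decreasing[OF assms, of i] by (simp add: psubset_eq del: stage.simps)
    then have less: "card (stage G S (Suc i)) < card (stage G S i)" for i
      by (intro psubset_card_mono finite_stage[OF assms])
    have "card (stage G S i) + i \<le> card (stage G S 0)" for i
    proof (induction i)
      case (Suc i)
      then show ?case using less[of i] by linarith
    qed simp
    from this[of "Suc (card (stage G S 0))"] show False by simp
  qed
  then obtain i where stable: "stage G S (Suc i) = stage G S i" ..
  have "rbe_lang (signature G (stage G S i) n) \<inter> rbe_lang (delta S t) \<noteq> {}"
    if "(n, t) \<in> stage G S i" for n t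
  proof -
    have "(n, t) \<in> stage G S (Suc i)" using that by (simp only: stable)
    then show ?thesis by simp
  qed
  then have "valid_typing G S (stage G S i)"
    using stage_subset[of G S i] unfolding valid_typing_def by blast
  then show thesis using that max_typing_greatest(2)[OF assms] by blast
qed

text \<open>A kind is a pair of an \<open>H\<close>-type set and a \<open>K\<close>-type set that a node of the
  counterexample has at some stage. It is represented by a node that has it at the earliest
  possible stage, so that its edges lead to kinds that occur earlier.\<close>

lemma exists_kind_system:
  fixes \<Sigma> :: "'l set" and G :: "'l graph"
  assumes fin: "finite \<Sigma>" and wf: "wf_schema \<Sigma> H" "wf_schema \<Sigma> K"
    and G: "simple_graph \<Sigma> G" "satisfies G H" "\<not> satisfies G K"
  obtains m d :: nat and dec :: "nat \<Rightarrow> 'l \<times> nat" and \<tau>H \<tau>K :: "nat \<Rightarrow> nat set"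
    and z :: "nat \<Rightarrow> nat \<Rightarrow> nat" and rank :: "nat \<Rightarrow> nat" and j0 :: nat where
    "m \<le> 2 ^ (card (types H) + card (types K))"
    "bij_betw dec {..<d} (\<Sigma> \<times> {..<m})"
    "\<And>j. j < m \<Longrightarrow> \<tau>H j \<subseteq> types H" "\<And>j. j < m \<Longrightarrow> \<tau>H j \<noteq> {}" "\<And>j. j < m \<Longrightarrow> \<tau>K j \<subseteq> types K"
    "j0 < m" "\<tau>K j0 = {}"
    "\<And>j t. j < m \<Longrightarrow> t \<in> \<tau>H j \<Longrightarrow>
      distr {..<d} (\<lambda>b. {fst (dec b)} \<times> \<tau>H (snd (dec b))) (z j) \<inter> rbe_lang (delta H t) \<noteq> {}"
    "\<And>j t. j < m \<Longrightarrow> t \<in> types K - \<tau>K j \<Longrightarrow>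
      distr {..<d} (\<lambda>b. {fst (dec b)} \<times> \<tau>K (snd (dec b))) (z j) \<inter> rbe_lang (delta K t) = {}"
    "\<And>j b. j < m \<Longrightarrow> \<not> types K \<subseteq> \<tau>K j \<Longrightarrow> b < d \<Longrightarrow> 0 < z j b \<Longrightarrow>
      rank (snd (dec b)) < rank j"
proof -
  have wfG: "wf_graph \<Sigma> G" and occ: "\<And>e. e \<in> edges G \<Longrightarrow> occur G e = singleton_interval 1"
    using G(1) by (auto simp: simple_graph_def)
  have edge: "lab G e \<in> \<Sigma>" "target G e \<in> nodes G" if "e \<in> out_edges G n" for e n
    using wfG that by (auto simp: wf_graph_def out_edges_def)
  have finG: "finite (edges G)" "finite (out_edges G n)" for n
    using wfG by (auto simp: wf_graph_def out_edges_def)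
  have finS: "finite (types H)" "finite (types K)" using wf by (auto simp: wf_schema_def)
  note mt = max_typing_greatest(1)[OF wfG wf(1)]
  have mt_sub: "max_typing G H \<subseteq> nodes G \<times> types H" using mt by (simp add: valid_typing_def)
  have mt_fin: "finite (max_typing G H)"
    by (rule finite_subset[OF mt_sub]) (use wfG finS in \<open>simp add: wf_graph_def\<close>)
  define kind where "kind i n = (max_typing G H `` {n}, stage G K i `` {n})" for i n
  define KS where "KS = {kind i n | i n. n \<in> nodes G}"
  have KS_sub: "KS \<subseteq> Pow (types H) \<times> Pow (types K)"
    using mt_sub stage_subset[of G K] by (auto simp: KS_def kind_def)
  have finPow: "finite (Pow (types H) \<times> Pow (types K))" using finS by simp
  then have finKS: "finite KS" using KS_sub finite_subset by blast
  define m where "m = card KS"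
  define d where "d = card (\<Sigma> \<times> {..<m})"
  have m: "m \<le> 2 ^ (card (types H) + card (types K))"
    using card_mono[OF finPow KS_sub] finS
    by (simp add: m_def card_cartesian_product card_Pow power_add)
  obtain en where en: "bij_betw en {..<m} KS"
    using ex_bij_betw_nat_finite[OF finKS] by (auto simp: m_def lessThan_atLeast0)
  have "finite (\<Sigma> \<times> {..<m})" using fin by simp
  from ex_bij_betw_nat_finite[OF this] obtain dec where dec: "bij_betw dec {..<d} (\<Sigma> \<times> {..<m})"
    by (auto simp: d_def lessThan_atLeast0)
  \<comment> \<open>The earliest stage at which kind \<open>j\<close> occurs; it is the measure that
    will order the refutations.\<close>
  define rank where "rank j = (LEAST i. \<exists>n\<in>nodes G. kind i n = en j)" for j
  have occurs: "\<exists>i. \<exists>n\<in>nodes G. kind i n = en j" if "j < m" for j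
  proof -
    have "en j \<in> KS" using en that by (auto simp: bij_betw_def)
    then obtain i n where "n \<in> nodes G" "kind i n = en j" by (auto simp: KS_def)
    then show ?thesis by blast
  qed
  have "\<exists>n\<in>nodes G. kind (rank j) n = en j" if "j < m" for j
    unfolding rank_def by (rule LeastI_ex[OF occurs[OF that]])
  then obtain rep where rep: "\<And>j. j < m \<Longrightarrow> rep j \<in> nodes G" "\<And>j. j < m \<Longrightarrow> kind (rank j) (rep j) = en j"
    by metis
  have rank_le: "rank j \<le> i" if "kind i n = en j" "n \<in> nodes G" for i j n
    unfolding rank_def using that by (intro Least_le) blast
  \<comment> \<open>The slot of edge \<open>e\<close>: its label, and the kind of its target one
    stage before \<open>rank j\<close>. The \<open>H\<close>-types do not depend on the stage, so
    they survive this shift. For \<open>rank j = 0\<close> truncated subtraction gives stage 0,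
    where no \<open>K\<close>-type is to be refuted.\<close>
  define h where "h j e = inv_into {..<d} dec
    (lab G e, inv_into {..<m} en (kind (rank j - 1) (target G e)))" for j e
  define z where "z j b = card {e \<in> out_edges G (rep j). h j e = b}" for j b
  have h: "h j e < d" "fst (dec (h j e)) = lab G e"
    "en (snd (dec (h j e))) = kind (rank j - 1) (target G e)"
    if "e \<in> out_edges G n" for j e n
  proof -
    have "kind (rank j - 1) (target G e) \<in> KS" using edge[OF that] by (auto simp: KS_def)
    then have inv: "en (inv_into {..<m} en (kind (rank j - 1) (target G e))) = kind (rank j - 1) (target G e)"
      "inv_into {..<m} en (kind (rank j - 1) (target G e)) < m"
      using en by (auto simp: bij_betw_def f_inv_into_f dest: inv_into_into[of _ en "{..<m}"])
    then have "(lab G e, inv_into {..<m} en (kind (rank j - 1) (target G e))) \<in> dec ` {..<d}"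
      using edge[OF that] dec by (auto simp: bij_betw_def)
    then have "dec (h j e) = (lab G e, inv_into {..<m} en (kind (rank j - 1) (target G e)))"
      "h j e \<in> {..<d}"
      unfolding h_def by (rule f_inv_into_f, rule inv_into_into)
    then show "h j e < d" "fst (dec (h j e)) = lab G e"
      "en (snd (dec (h j e))) = kind (rank j - 1) (target G e)"
      using inv by auto
  qed
  \<comment> \<open>With \<open>\<tau>\<close> left open, the same multiplicities \<open>z j\<close>
    describe the signature for the \<open>H\<close>-types and for the
    \<open>K\<close>-types.\<close>
  have sig: "rbe_lang (signature G T (rep j)) =
      distr {..<d} (\<lambda>b. {fst (dec b)} \<times> \<tau> (snd (dec b))) (z j)"
    if "finite T" and \<tau>: "\<And>e. e \<in> out_edges G (rep j) \<Longrightarrow> \<tau> (snd (dec (h j e))) = T `` {target G e}"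
    for T \<tau> j
  proof -
    have "rbe_lang (signature G T (rep j)) =
        distr (out_edges G (rep j)) (\<lambda>e. {lab G e} \<times> T `` {target G e}) (\<lambda>_. 1)"
      by (rule signature_distr[OF finG(1) that(1)]) (use occ in \<open>auto simp: out_edges_def\<close>)
    also have "\<dots> = distr {..<d} (\<lambda>b. {fst (dec b)} \<times> \<tau> (snd (dec b))) (z j)"
      unfolding z_def by (rule distr_group[OF finG(2)]) (use h \<tau> in auto)
    finally show ?thesis .
  qed
  obtain n where n: "n \<in> nodes G" "max_typing G K `` {n} = {}"
    using G(3) by (auto simp: satisfies_def)
  obtain i where "stage G K i \<subseteq> max_typing G K"
    using stage_reaches_max_typing[OF wfG wf(2)] by blast
  \<comment> \<open>Once the stages have stabilised, a node without maximal \<open>K\<close>-type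
    has a kind with empty \<open>K\<close>-part.\<close>
  then have "snd (kind i n) = {}" "kind i n \<in> KS" using n by (auto simp: kind_def KS_def)
  then obtain j0 where "j0 < m" "snd (en j0) = {}" using en by (auto simp: bij_betw_def)
  show thesis
  proof (rule that[of m dec d "\<lambda>j. fst (en j)" "\<lambda>j. snd (en j)" j0 z rank])
    show "m \<le> 2 ^ (card (types H) + card (types K))" "bij_betw dec {..<d} (\<Sigma> \<times> {..<m})"
      by fact+
    have en_sub: "en j \<in> Pow (types H) \<times> Pow (types K)" if "j < m" for j
      using en KS_sub that by (auto simp: bij_betw_def)
    then show "fst (en j) \<subseteq> types H" "snd (en j) \<subseteq> types K" if "j < m" for j
      using that by (metis PowD mem_Times_iff)+
    show "fst (en j) \<noteq> {}" if j: "j < m" for j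
    proof -
      obtain t where "(rep j, t) \<in> max_typing G H"
        using G(2) rep(1)[OF j] by (auto simp: satisfies_def)
      then show ?thesis by (auto simp: kind_def simp flip: rep(2)[OF j])
    qed
    show "j0 < m" "snd (en j0) = {}" by fact+
  next
    fix j t assume j: "j < m" and t: "t \<in> fst (en j)"
    then have "(rep j, t) \<in> max_typing G H" by (auto simp: kind_def simp flip: rep(2)[OF j])
    then have "rbe_lang (signature G (max_typing G H) (rep j)) \<inter> rbe_lang (delta H t) \<noteq> {}"
      using mt unfolding valid_typing_def by blast
    also have "rbe_lang (signature G (max_typing G H) (rep j)) =
        distr {..<d} (\<lambda>b. {fst (dec b)} \<times> fst (en (snd (dec b)))) (z j)"
      by (rule sig[OF mt_fin]) (simp add: h(3) kind_def)
    finally show "distr {..<d} (\<lambda>b. {fst (dec b)} \<times> fst (en (snd (dec b)))) (z j) \<inter>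
        rbe_lang (delta H t) \<noteq> {}" .
  next
    fix j t assume j: "j < m" and t: "t \<in> types K - snd (en j)"
    have snd_en: "snd (en j) = stage G K (rank j) `` {rep j}"
      by (simp add: kind_def flip: rep(2)[OF j])
    show "distr {..<d} (\<lambda>b. {fst (dec b)} \<times> snd (en (snd (dec b)))) (z j) \<inter>
        rbe_lang (delta K t) = {}"
    \<comment> \<open>At stage 0 every type of \<open>K\<close> is present. At stage
      \<open>Suc i\<close> a missing type fails against the targets at stage \<open>i\<close>, which
      is the stage used by \<open>h\<close>.\<close>
    proof (cases "rank j")
      case 0
      then show ?thesis using t snd_en rep(1)[OF j] by auto
    next
      case (Suc i)
      then have "rbe_lang (signature G (stage G K i) (rep j)) \<inter> rbe_lang (delta K t) = {}"
        using t snd_en rep(1)[OF j] by auto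
      also have "rbe_lang (signature G (stage G K i) (rep j)) =
          distr {..<d} (\<lambda>b. {fst (dec b)} \<times> snd (en (snd (dec b)))) (z j)"
        by (rule sig[OF finite_stage[OF wfG wf(2)]]) (simp add: h(3) kind_def Suc)
      finally show ?thesis .
    qed
  next
    fix j b assume j: "j < m" and ne: "\<not> types K \<subseteq> snd (en j)" and b: "b < d" "0 < z j b"
    have "rank j \<noteq> 0"
      using ne rep(1)[OF j] by (intro notI) (auto simp: kind_def simp flip: rep(2)[OF j])
    from b(2) have "{e \<in> out_edges G (rep j). h j e = b} \<noteq> {}"
      unfolding z_def by (metis card.empty less_irrefl)
    then obtain e where e: "e \<in> out_edges G (rep j)" "h j e = b" by blast
    have "kind (rank j - 1) (target G e) = en (snd (dec b))" using h(3)[OF e(1), of j] e(2) by simp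
    then have "rank (snd (dec b)) \<le> rank j - 1" using rank_le edge(2)[OF e(1)] by blast
    then show "rank (snd (dec b)) < rank j" using \<open>rank j \<noteq> 0\<close> by linarith
  qed
qed

section \<open>Bounds\<close>

lemma level_exp_eq: "level_exp l j + 1 = 2 ^ j * (l + 1)"
  by (induction j) auto

text \<open>From \<open>N! \<le> N ^ N\<close> with \<open>N = 2 ^ e\<close>. The product at the
  next level only raises the inner exponent \<open>3 * e\<close> by 1, well below
  \<open>3 * (2 * e + 1)\<close>.\<close>

lemma level_mod_le: "level_mod l j \<le> 2 ^ (2 ^ (3 * level_exp l j))"
proof (induction j)
  case 0
  then show ?case by simp
next
  case (Suc j)
  let ?e = "level_exp l j"
  have "fact (2 ^ ?e) \<le> ((2 ^ ?e) ^ (2 ^ ?e) :: nat)"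
    using fact_le_power[of "2 ^ ?e", where 'a = nat] by simp
  also have "\<dots> = 2 ^ (?e * 2 ^ ?e)" by (simp add: power_mult)
  also have "\<dots> \<le> 2 ^ (2 ^ (3 * ?e))"
  proof (intro power_increasing)
    have "?e * 2 ^ ?e \<le> 2 ^ ?e * 2 ^ ?e" by (intro mult_le_mono1) (simp add: less_imp_le)
    also have "\<dots> \<le> 2 ^ (3 * ?e)" unfolding power_add[symmetric] by (intro power_increasing) auto
    finally show "?e * 2 ^ ?e \<le> 2 ^ (3 * ?e)" .
  qed simp
  finally have "int (fact (2 ^ ?e)) \<le> int (2 ^ (2 ^ (3 * ?e)))" by (simp only: of_nat_le_iff)
  then have "fact (2 ^ ?e) \<le> (2 :: int) ^ (2 ^ (3 * ?e))" by simp
  then have "level_mod l (Suc j) \<le> 2 ^ (2 ^ (3 * ?e)) * 2 ^ (2 ^ (3 * ?e))"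
    using Suc.IH level_mod_ge_1[of l j] by (auto intro!: mult_mono)
  also have "\<dots> = 2 ^ (2 ^ (3 * ?e + 1))" by (simp flip: power_add mult_2)
  also have "\<dots> \<le> 2 ^ (2 ^ (3 * level_exp l (Suc j)))"
    by (intro power_increasing) auto
  finally show ?case .
qed

text \<open>\<open>2 ^ q\<close> bounds both the number of variables and the exponent of the
  coefficient bound. The factor \<open>8 ^ n\<close> and the logarithm of the modulus are then
  doubly exponential in \<open>q\<close>, which makes the entries triply exponential.\<close>

lemma sim_small:
  assumes "2 \<le> l" "n \<le> 2 ^ q" "level_exp l J \<le> 2 ^ q"
  obtains z' :: "nat \<Rightarrow> nat" where "sim l J n (\<lambda>i. int (z i)) (\<lambda>i. int (z' i))"
    "\<And>i. i < n \<Longrightarrow> z' i \<le> 2 ^ 2 ^ 2 ^ (q + 4)"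
proof -
  let ?L = "level_exp l J"
  define v where "v = (2::nat) ^ (3 * ?L)"
  define w where "w = n + ?L + v + ?L * 4 ^ n + 1"
  have "1 \<le> ?L" using level_exp_ge[of l J] assms(1) by simp
  then obtain x' where x': "lsim (2 ^ ?L) (level_mod l J) n (\<lambda>i. int (z i)) x'"
    and small: "\<And>i. i < n \<Longrightarrow> \<bar>x' i\<bar> \<le> 2 ^ ((w + ?L) * 8 ^ n)"
    using lsim_small[OF _ level_mod_ge_1 level_mod_le, of ?L l J n "\<lambda>i. int (z i)"]
    unfolding v_def w_def by blast
  have sim: "sim l J n (\<lambda>i. int (z i)) x'" using x' by (simp add: sim_def)
  \<comment> \<open>The equivalence preserves the sign of each coordinate, so the small integer
    vector again consists of multiplicities.\<close>
  have nonneg: "0 \<le> x' i" if "i < n" for i using sim_nonneg_iff[OF sim that] by simp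
  \<comment> \<open>A common yardstick for the exponents, with
    \<open>4 * u = 2 ^ (q + 4)\<close>.\<close>
  define u where "u = (2::nat) ^ (q + 2)"
  have n: "4 * n \<le> u" "4 * ?L \<le> u" using assms(2,3) by (auto simp: u_def power_add)
  have bound: "(w + ?L) * 8 ^ n \<le> 2 ^ 2 ^ (q + 4)"
  proof -
    have u: "u < 2 ^ u" by simp
    have "v \<le> 2 ^ u" unfolding v_def using n(2) by (intro power_increasing) auto
    moreover have "?L * 4 ^ n \<le> 2 ^ u * 2 ^ u"
    proof (intro mult_le_mono)
      show "?L \<le> 2 ^ u" using n(2) u by linarith
      have "(4::nat) ^ n = 2 ^ (2 * n)" by (simp add: power_mult)
      also have "\<dots> \<le> 2 ^ u" using n(1) by (intro power_increasing) auto
      finally show "(4::nat) ^ n \<le> 2 ^ u" .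
    qed
    moreover have "(2::nat) ^ u * 1 \<le> 2 ^ u * 2 ^ u" by (intro mult_le_mono2) simp
    ultimately have "w + ?L \<le> 4 * (2 ^ u * 2 ^ u)" using u n unfolding w_def by linarith
    also have "\<dots> = 2 ^ (u + u + 2)" by (simp add: power_add)
    finally have "(w + ?L) * 8 ^ n \<le> 2 ^ (u + u + 2) * 2 ^ (3 * n)"
      by (intro mult_le_mono) (auto simp: power_mult)
    also have "\<dots> = 2 ^ (u + u + 2 + 3 * n)" by (simp only: power_add)
    also have "\<dots> \<le> 2 ^ 2 ^ (q + 4)"
    proof (intro power_increasing)
      have "4 \<le> u" by (simp add: u_def power_add)
      moreover have "2 ^ (q + 4) = 4 * u" by (simp add: u_def power_add)
      ultimately show "u + u + 2 + 3 * n \<le> 2 ^ (q + 4)" using n(1) by linarith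
    qed simp
    finally show ?thesis .
  qed
  show thesis
  proof (rule that[of "\<lambda>i. nat (x' i)"])
    show "sim l J n (\<lambda>i. int (z i)) (\<lambda>i. int (nat (x' i)))"
      using sim nonneg unfolding sim_def by (auto intro: lsim_cong)
    fix i assume i: "i < n"
    have "x' i \<le> 2 ^ ((w + ?L) * 8 ^ n)" using small[OF i] by simp
    also have "\<dots> \<le> 2 ^ 2 ^ 2 ^ (q + 4)" by (intro power_increasing bound) simp
    finally show "nat (x' i) \<le> 2 ^ 2 ^ 2 ^ (q + 4)" by (simp add: nat_le_iff)
  qed
qed

lemma nbits_le: "k \<le> 2 ^ e \<Longrightarrow> nbits k \<le> e + 1"
proof -
  assume "k \<le> 2 ^ e"
  then have "k < 2 ^ (e + 1)" by (simp add: le_less_trans)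
  then have "floorlog 2 k \<le> e + 1" by (intro floorlog_leI) auto
  then show ?thesis by (simp add: nbits_def)
qed

lemma schema_size_bounds:
  fixes \<Sigma> :: "'l set" and S :: "'l schema"
  assumes "wf_schema \<Sigma> S"
  shows "card (types S) \<le> schema_size \<Sigma> S"
    and "t \<in> types S \<Longrightarrow>
      rbe_size (nbits (card \<Sigma>) + nbits (card (types S))) (delta S t) \<le> schema_size \<Sigma> S"
proof -
  have fin: "finite (types S)" using assms by (simp add: wf_schema_def)
  have "(\<Sum>t\<in>types S. 1) \<le> schema_size \<Sigma> S"
    unfolding schema_size_def by (rule sum_mono) (simp add: nbits_def trans_le_add1)
  then show "card (types S) \<le> schema_size \<Sigma> S" by simp
  show "rbe_size (nbits (card \<Sigma>) + nbits (card (types S))) (delta S t) \<le> schema_size \<Sigma> S"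
    if "t \<in> types S"
    using member_le_sum[OF that _ fin, of "\<lambda>t. nbits (card (types S)) +
      rbe_size (nbits (card \<Sigma>) + nbits (card (types S))) (delta S t)"]
    by (simp add: schema_size_def)
qed

text \<open>A multiplicity has at most \<open>Y + 1\<close> bits, stored twice per edge, and there
  are at most \<open>Y * Y\<close> edges. The final constant comes from
  \<open>8 * Y^3 \<le> Y^6\<close> and \<open>6 * 2 ^ (q + 4) \<le> 2 ^ (q + 7)\<close>.\<close>

lemma graph_size_kind_graph:
  fixes \<Sigma> :: "'l set"
  assumes z: "\<And>j b. j < m \<Longrightarrow> b < d \<Longrightarrow> z j b \<le> 2 ^ 2 ^ 2 ^ (q + 4)"
    and "m \<le> 2 ^ q" "d \<le> 2 ^ q" "card \<Sigma> \<le> q"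
  shows "graph_size \<Sigma> (kind_graph m d dec z) \<le> 2 ^ 2 ^ (q + 7)"
proof -
  define Y where "Y = (2::nat) ^ 2 ^ (q + 4)"
  have q: "q + 1 \<le> 2 ^ q" using less_exp[of q] by linarith
  have "(2::nat) ^ q \<le> Y"
  proof -
    have "q < 2 ^ q" by simp
    also have "(2::nat) ^ q \<le> 2 ^ (q + 4)" by (intro power_increasing) auto
    finally show ?thesis unfolding Y_def by (intro power_increasing) auto
  qed
  then have le: "m \<le> Y" "d \<le> Y" "q + 1 \<le> Y" using assms(2,3) q by linarith+
  have Y2: "2 \<le> Y" unfolding Y_def by (rule self_le_power[of 2, THEN order_trans[rotated]]) auto
  have nm: "nbits m \<le> Y" using nbits_le[OF assms(2)] le(3) by linarith
  have "card \<Sigma> \<le> 2 ^ q" using assms(4) q by linarith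
  then have ns: "nbits (card \<Sigma>) \<le> Y" using nbits_le le(3) by (meson le_trans)
  have edge: "2 * nbits m + nbits (card \<Sigma>) + interval_size (singleton_interval (z (e div d) (e mod d))) \<le> 7 * Y"
    if "e < m * d" for e
  proof -
    have "nbits (z (e div d) (e mod d)) \<le> Y + 1"
      using nbits_le z[OF kind_graph_index[OF that]] by (simp add: Y_def)
    then show ?thesis
      using nm ns Y2 by (simp add: interval_size_def singleton_interval_def)
  qed
  have "graph_size \<Sigma> (kind_graph m d dec z) = m * nbits m +
      (\<Sum>e<m * d. 2 * nbits m + nbits (card \<Sigma>) + interval_size (singleton_interval (z (e div d) (e mod d))))"
    by (simp add: graph_size_def kind_graph_def)
  also have "\<dots> \<le> Y * Y + (\<Sum>e<m * d. 7 * Y)"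
    using le nm edge by (intro add_mono mult_le_mono sum_mono) auto
  also have "\<dots> \<le> Y * Y + Y * Y * (7 * Y)"
    using mult_le_mono[OF le(1,2)] by simp
  also have "\<dots> \<le> 8 * (Y * Y * Y)" using Y2 by simp
  also have "\<dots> \<le> (Y * Y * Y) * (Y * Y * Y)"
    using mult_le_mono[OF mult_le_mono[OF Y2 Y2] Y2] by (intro mult_le_mono1) simp
  also have "\<dots> = Y ^ 6" by (simp add: eval_nat_numeral)
  also have "\<dots> = 2 ^ (2 ^ (q + 4) * 6)" by (simp add: Y_def power_mult)
  also have "\<dots> \<le> 2 ^ 2 ^ (q + 7)" by (intro power_increasing) (auto simp: power_add)
  finally show ?thesis .
qed

theorem theorem7:
  fixes \<Sigma> :: "'l set"
  assumes "finite \<Sigma>"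
  shows "\<exists>p :: nat poly. \<forall>H K :: 'l schema.
    wf_schema \<Sigma> H \<longrightarrow> wf_schema \<Sigma> K \<longrightarrow> \<not> schema_lang \<Sigma> H \<subseteq> schema_lang \<Sigma> K \<longrightarrow>
    (\<exists>F :: 'l graph. compressed_graph \<Sigma> F \<and> satisfies F H \<and> \<not> satisfies F K \<and>
       graph_size \<Sigma> F \<le> 2 ^ (2 ^ poly p (schema_size \<Sigma> H + schema_size \<Sigma> K)))"
proof (intro exI[of _ "[:2, 2 * card \<Sigma>:] * [:1, 1:] + [:card \<Sigma> + 10, 1:]"] allI impI)
  fix H K :: "'l schema"
  assume wf: "wf_schema \<Sigma> H" "wf_schema \<Sigma> K" and "\<not> schema_lang \<Sigma> H \<subseteq> schema_lang \<Sigma> K"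
  then obtain G where G: "simple_graph \<Sigma> G" "satisfies G H" "\<not> satisfies G K"
    by (auto simp: schema_lang_def)
  obtain m d and dec :: "nat \<Rightarrow> 'l \<times> nat" and \<tau>H \<tau>K z rank j0 where
    m: "m \<le> 2 ^ (card (types H) + card (types K))"
    and dec: "bij_betw dec {..<d} (\<Sigma> \<times> {..<m})"
    and types: "\<And>j. j < m \<Longrightarrow> \<tau>H j \<subseteq> types H" "\<And>j. j < m \<Longrightarrow> \<tau>H j \<noteq> {}"
      "\<And>j. j < m \<Longrightarrow> \<tau>K j \<subseteq> types K"
    and j0: "j0 < m" "\<tau>K j0 = {}"
    and valid: "\<And>j t. j < m \<Longrightarrow> t \<in> \<tau>H j \<Longrightarrow>
      distr {..<d} (\<lambda>b. {fst (dec b)} \<times> \<tau>H (snd (dec b))) (z j) \<inter> rbe_lang (delta H t) \<noteq> {}"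
    and invalid: "\<And>j t. j < m \<Longrightarrow> t \<in> types K - \<tau>K j \<Longrightarrow>
      distr {..<d} (\<lambda>b. {fst (dec b)} \<times> \<tau>K (snd (dec b))) (z j) \<inter> rbe_lang (delta K t) = {}"
    and rank: "\<And>j b. j < m \<Longrightarrow> \<not> types K \<subseteq> \<tau>K j \<Longrightarrow> b < d \<Longrightarrow> 0 < z j b \<Longrightarrow>
      (rank (snd (dec b)) :: nat) < rank j"
    by (rule exists_kind_system[OF assms wf G]) blast
  define s where "s = schema_size \<Sigma> H + schema_size \<Sigma> K"
  \<comment> \<open>The number of rounds that \<open>match_transfer\<close> requires, uniformly for
    all types of both schemas: the alphabet of typed labels has at most
    \<open>card \<Sigma> * s\<close> elements and each expression has size at most
    \<open>s\<close>.\<close>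
  define J where "J = (2 * (card \<Sigma> * s) + 2) * (s + 1)"
  \<comment> \<open>Large enough for \<open>d\<close>, which is at most
    \<open>2 ^ (card \<Sigma> + s)\<close>, and for the level exponent, which is at most
    \<open>2 ^ (J + s + 3)\<close>.\<close>
  define q where "q = J + s + card \<Sigma> + 3"
  have s: "schema_size \<Sigma> H \<le> s" "schema_size \<Sigma> K \<le> s" by (auto simp: s_def)
  have "card (types H) + card (types K) \<le> s"
    using schema_size_bounds(1) wf by (auto simp: s_def intro: add_mono)
  then have ms: "m \<le> 2 ^ s" using m by (meson le_trans one_le_numeral power_increasing)
  have "d = card \<Sigma> * m" using bij_betw_same_card[OF dec] by (simp add: card_cartesian_product)
  also have "\<dots> \<le> 2 ^ card \<Sigma> * 2 ^ s" using ms by (intro mult_le_mono) (auto simp: less_imp_le)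
  also have "\<dots> = 2 ^ (card \<Sigma> + s)" by (simp add: power_add)
  also have "\<dots> \<le> 2 ^ q" by (intro power_increasing) (auto simp: q_def)
  finally have dq: "d \<le> 2 ^ q" .
  have "(2::nat) ^ s \<le> 2 ^ q" by (intro power_increasing) (auto simp: q_def)
  with ms have mq: "m \<le> 2 ^ q" by (rule le_trans)
  have "level_exp (s + 2) J \<le> 2 ^ J * (s + 3)" using level_exp_eq[of "s + 2" J] by (simp add: algebra_simps)
  also have "\<dots> \<le> 2 ^ J * 2 ^ (s + 3)" by (intro mult_le_mono2) (simp add: less_imp_le)
  also have "\<dots> = 2 ^ (J + (s + 3))" by (simp only: power_add)
  also have "\<dots> \<le> 2 ^ q" by (intro power_increasing) (auto simp: q_def)
  finally have Lq: "level_exp (s + 2) J \<le> 2 ^ q" .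
  have "\<exists>z'. sim (s + 2) J d (\<lambda>b. int (z j b)) (\<lambda>b. int (z' b)) \<and>
      (\<forall>b<d. z' b \<le> 2 ^ 2 ^ 2 ^ (q + 4))" for j
    by (rule sim_small[OF _ dq Lq, of "z j"]) auto
  then obtain z' where z': "\<And>j. sim (s + 2) J d (\<lambda>b. int (z j b)) (\<lambda>b. int (z' j b))"
    and small: "\<And>j b. b < d \<Longrightarrow> z' j b \<le> 2 ^ 2 ^ 2 ^ (q + 4)"
    by metis
  \<comment> \<open>Stated for arbitrary schema, typing and equivalent vectors, since
    \<open>H\<close> uses it from the old multiplicities to the new ones and \<open>K\<close> in the
    opposite direction.\<close>
  have transfer: "distr {..<d} (\<lambda>b. {fst (dec b)} \<times> \<tau> (snd (dec b))) y' \<inter> rbe_lang (delta S t) \<noteq> {}"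
    if S: "wf_schema \<Sigma> S" "schema_size \<Sigma> S \<le> s" "t \<in> types S"
      and \<tau>: "\<And>j. j < m \<Longrightarrow> \<tau> j \<subseteq> types S"
      and sim: "sim (s + 2) J d (\<lambda>b. int (y b)) (\<lambda>b. int (y' b))"
      and ne: "distr {..<d} (\<lambda>b. {fst (dec b)} \<times> \<tau> (snd (dec b))) y \<inter> rbe_lang (delta S t) \<noteq> {}"
    for S :: "'l schema" and \<tau> t y y'
  proof (rule match_transfer[OF _ _ _ _ _ _ ne])
    let ?c = "nbits (card \<Sigma>) + nbits (card (types S))"
    have size: "card (types S) \<le> s" "rbe_size ?c (delta S t) \<le> s"
      using schema_size_bounds[OF S(1)] S(2,3) by (auto intro: le_trans)
    show "finite (\<Sigma> \<times> types S)" "rbe_over (\<Sigma> \<times> types S) (delta S t)"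
      using S assms by (auto simp: wf_schema_def)
    show "rbe_size ?c (delta S t) \<le> s + 2" using size by simp
    show "{fst (dec b)} \<times> \<tau> (snd (dec b)) \<subseteq> \<Sigma> \<times> types S" if "b < d" for b
    proof -
      have "dec b \<in> \<Sigma> \<times> {..<m}" using dec that by (auto simp: bij_betw_def)
      then show ?thesis using \<tau>[of "snd (dec b)"] by auto
    qed
    show "sim (s + 2) ((2 * card (\<Sigma> \<times> types S) + 2) * (rbe_size ?c (delta S t) + 1)) d
        (\<lambda>b. int (y b)) (\<lambda>b. int (y' b))"
      unfolding card_cartesian_product
      by (rule sim_mono[OF sim]) (use size in \<open>auto simp: J_def intro!: mult_le_mono add_mono\<close>)
  qed simp
  let ?F = "kind_graph m d dec z'"
  have valid': "distr {..<d} (\<lambda>b. {fst (dec b)} \<times> \<tau>H (snd (dec b))) (z' j) \<inter> rbe_lang (delta H t) \<noteq> {}"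
    if "j < m" "t \<in> \<tau>H j" for j t
    using types(1) that by (intro transfer[OF wf(1) s(1) _ types(1) z' valid]) auto
  have invalid': "distr {..<d} (\<lambda>b. {fst (dec b)} \<times> \<tau>K (snd (dec b))) (z' j) \<inter> rbe_lang (delta K t) = {}"
    if "j < m" "t \<in> types K - \<tau>K j" for j t
  \<comment> \<open>A match created by shrinking would transfer back to the original multiplicities
    by symmetry of the equivalence.\<close>
  proof (rule ccontr)
    assume "\<not> ?thesis"
    from transfer[OF wf(2) s(2) _ types(3) sim_sym[OF z'] this] invalid[OF that] that(2)
    show False by simp
  qed
  \<comment> \<open>The equivalence preserves which multiplicities are 0, so no new edge can violate
    the ranking.\<close>
  have rank': "rank (snd (dec b)) < rank j"
    if "j < m" "\<not> types K \<subseteq> \<tau>K j" "b < d" "0 < z' j b" for j b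
    using rank[OF that(1-3)] sim_zero_iff[OF z' that(3), of j] that(4) by simp
  note counterexample = kind_graph_counterexample[where \<tau>H = \<tau>H and \<tau>K = \<tau>K and rank = rank and z = z' and ?j0.0 = j0,
    OF wf dec types(1,2) j0 valid' invalid' rank']
  have "satisfies ?F H" "\<not> satisfies ?F K" by (rule counterexample; assumption)+
  moreover have "compressed_graph \<Sigma> ?F" by (rule compressed_kind_graph[OF dec])
  moreover have "graph_size \<Sigma> ?F \<le> 2 ^ 2 ^ (q + 7)"
    by (rule graph_size_kind_graph[OF small mq dq]) (auto simp: q_def)
  moreover have "q + 7 = poly ([:2, 2 * card \<Sigma>:] * [:1, 1:] + [:card \<Sigma> + 10, 1:]) s"
    by (simp add: q_def J_def algebra_simps)
  ultimately show "\<exists>F :: 'l graph. compressed_graph \<Sigma> F \<and> satisfies F H \<and> \<not> satisfies F K \<and>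
      graph_size \<Sigma> F \<le> 2 ^ 2 ^ poly ([:2, 2 * card \<Sigma>:] * [:1, 1:] + [:card \<Sigma> + 10, 1:])
        (schema_size \<Sigma> H + schema_size \<Sigma> K)"
    unfolding s_def by (intro exI[of _ ?F]) simp
qed

end
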